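(* Let $\{f_\mu\}$ be a family of PWL orientation preserving homeomorphisms of the circle, with $\mu$ in an open interval, whose lifts $F_\mu$ are defined by $C^2$ functions $b_k(\mu)$ (break points) and $\phi_k(\mu)=F_\mu(b_k(\mu))$, $1\le k\le n$. Suppose there exists $\mu_c$ such that $f_{\mu_c}$ is conjugate to a rigid rational rotation with rotation number $p/q$ (i.e. $\rho(F_{\mu_c})=p/q$), and that the transversality condition $$\phi_k'(\mu_c)-\max\{0,\ s_{k-1}(\mu_c)\,b_k'(\mu_c),\ s_k(\mu_c)\,b_k'(\mu_c)\}>0,\qquad k=1,\dots,n,$$ holds. Then there exist a neighbourhood $\mathcal{N}$ of $\mu=\mu_c$ and constants $R_1>0$ and $R_2>0$ such that $$\left|\rho(F_\mu)-\frac{p}{q}-R_1(\mu-\mu_c)\right|\le R_2(\mu-\mu_c)^2\quad\text{for all }\mu\in\mathcal{N}.$$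
   Context: The circle $\mathbb{S}^1=\mathbb{R}/\mathbb{Z}$. An orientation preserving homeomorphism $f$ of the circle is described by a lift $F:\mathbb{R}\to\mathbb{R}$, continuous and strictly increasing with $F(x+1)=F(x)+1$ and $f(x)=F(x)\ (\mathrm{mod}\ 1)$. The rotation number of a lift is $\rho(F)=\lim_{m\to\infty}\frac1m(F^m(x)-x)$ (it exists and is independent of $x$). A rigid rational rotation is a map $r_\omega(x)=x+\omega\ (\mathrm{mod}\ 1)$ with $\omega$ rational; $f,g$ are conjugate if there is a homeomorphism $h$ of the circle with $h\circ f=g\circ h$. A family of PWL (piecewise linear) circle maps with $n\ge 2$ break points is described by pairs $(b_k(\mu),\phi_k(\mu))$, $1\le k\le n$, where the break points satisfy $b_1(\mu)<b_2(\mu)<\dots<b_n(\mu)<b_{n+1}(\mu)=b_1(\mu)+1$, and $\phi_{n+1}(\mu)=\phi_1(\mu)+1$. The lift $F_\mu$ satisfies $F_\mu(b_k(\mu))=\phi_k(\mu)$ and $$F_\mu(x)=\phi_k(\mu)+s_k(\mu)(x-b_k(\mu))\quad\text{if }x\in[b_k(\mu),b_{k+1}(\mu)),\qquad s_k(\mu)=\frac{\phi_{k+1}(\mu)-\phi_k(\mu)}{b_{k+1}(\mu)-b_k(\mu)},$$ for $k=1,\dots,n$, extended to $\mathbb{R}$ by $F_\mu(x+1)=F_\mu(x)+1$. Here $s_k(\mu)>0$, and $s_k(\mu)\ne s_{k-1}(\mu)$, with the cyclic convention $s_0=s_n$. A prime on $b_k$ or $\phi_k$ denotes $d/d\mu$.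 *)

theory Defs
  imports "HOL-Analysis.Analysis"
begin

quotient_type circle = real / "\<lambda>x y. x - y \<in> \<int>"
proof (rule equivpI)
  show "reflp (\<lambda>x y :: real. x - y \<in> \<int>)"
    by (simp add: reflp_def)
  show "symp (\<lambda>x y :: real. x - y \<in> \<int>)"
    by (metis (mono_tags, lifting) Ints_minus minus_diff_eq sympI)
  show "transp (\<lambda>x y :: real. x - y \<in> \<int>)"
  proof (rule transpI)
    fix x y z :: real
    assume "x - y \<in> \<int>" "y - z \<in> \<int>"
    then have "(x - y) + (y - z) \<in> \<int>" by (rule Ints_add)
    then show "x - z \<in> \<int>" by simp
  qed
qed

lift_definition circle_of :: "real \<Rightarrow> circle" is "\<lambda>x. x" .

lemma circle_of_eq_iff: "circle_of x = circle_of y \<longleftrightarrow> x - y \<in> \<int>"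
  by transfer simp

lemma surj_circle_of: "surj circle_of"
proof (rule surjI)
  show "circle_of (rep_circle c) = c" for c
    unfolding circle_of_def using Quotient3_circle
    by (simp add: Quotient3_abs_rep)
qed

instantiation circle :: topological_space
begin

definition open_circle :: "circle set \<Rightarrow> bool" where
  "open_circle U \<longleftrightarrow> open (circle_of -` U)"

instance
  by standard (auto simp: open_circle_def vimage_Union)

end

text \<open>An orientation preserving homeomorphism of the circle is a map that has a lift
  in the following sense.\<close>

definition is_lift :: "(real \<Rightarrow> real) \<Rightarrow> (circle \<Rightarrow> circle) \<Rightarrow> bool" where
  "is_lift F f \<longleftrightarrow>
     continuous_on UNIV F \<and> strict_mono F \<and>
     (\<forall>x. F (x + 1) = F x + 1) \<and>
     (\<forall>x. f (circle_of x) = circle_of (F x))"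

text \<open>The value is meaningful only if the limit exists and is the same for every starting point.\<close>

definition rotation_number :: "(real \<Rightarrow> real) \<Rightarrow> real" where
  "rotation_number F =
     (THE r. \<forall>x. (\<lambda>m. ((F ^^ m) x - x) / real m) \<longlonglongrightarrow> r)"

lift_definition rigid_rotation :: "real \<Rightarrow> circle \<Rightarrow> circle" is "\<lambda>\<omega> x. x + \<omega>"
  by simp

definition circle_conjugate :: "(circle \<Rightarrow> circle) \<Rightarrow> (circle \<Rightarrow> circle) \<Rightarrow> bool" where
  "circle_conjugate f g \<longleftrightarrow> (\<exists>h h'. homeomorphism UNIV UNIV h h' \<and> h \<circ> f = g \<circ> h)"

definition C2_on :: "real set \<Rightarrow> (real \<Rightarrow> real) \<Rightarrow> bool" where
  "C2_on I g \<longleftrightarrow>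
     (\<forall>\<mu>\<in>I. g differentiable (at \<mu>)) \<and>
     (\<forall>\<mu>\<in>I. deriv g differentiable (at \<mu>)) \<and>
     continuous_on I (deriv (deriv g))"

text \<open>Break points and their images are indexed from \<open>1\<close> to \<open>n + 1\<close>; slopes from \<open>0\<close> to \<open>n\<close>,
  with the cyclic convention that the slope of index \<open>0\<close> is that of index \<open>n\<close>.\<close>

definition slope ::
  "nat \<Rightarrow> (nat \<Rightarrow> real \<Rightarrow> real) \<Rightarrow> (nat \<Rightarrow> real \<Rightarrow> real) \<Rightarrow> nat \<Rightarrow> real \<Rightarrow> real" where
  "slope n b \<phi> k \<mu> =
     (let j = (if k = 0 then n else k)
      in (\<phi> (j + 1) \<mu> - \<phi> j \<mu>) / (b (j + 1) \<mu> - b j \<mu>))"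

text \<open>For \<open>\<mu> \<in> I\<close> the last three conditions determine \<open>F \<mu>\<close> and \<open>f \<mu>\<close> uniquely, since the
  intervals \<open>[b\<^sub>k, b\<^sub>k\<^sub>+\<^sub>1)\<close>, \<open>1 \<le> k \<le> n\<close>, partition the fundamental domain \<open>[b\<^sub>1, b\<^sub>1 + 1)\<close>.\<close>

definition pwl_family ::
  "real set \<Rightarrow> nat \<Rightarrow> (nat \<Rightarrow> real \<Rightarrow> real) \<Rightarrow> (nat \<Rightarrow> real \<Rightarrow> real) \<Rightarrow>
   (real \<Rightarrow> real \<Rightarrow> real) \<Rightarrow> (real \<Rightarrow> circle \<Rightarrow> circle) \<Rightarrow> bool" where
  "pwl_family I n b \<phi> F f \<longleftrightarrow> (\<forall>\<mu>\<in>I.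
     (\<forall>k\<in>{1..n}. b k \<mu> < b (k + 1) \<mu>) \<and>
     b (n + 1) \<mu> = b 1 \<mu> + 1 \<and>
     \<phi> (n + 1) \<mu> = \<phi> 1 \<mu> + 1 \<and>
     (\<forall>k\<in>{1..n}. slope n b \<phi> k \<mu> > 0) \<and>
     (\<forall>k\<in>{1..n}. slope n b \<phi> k \<mu> \<noteq> slope n b \<phi> (k - 1) \<mu>) \<and>
     (\<forall>k\<in>{1..n}. \<forall>x\<in>{b k \<mu>..<b (k + 1) \<mu>}.
        F \<mu> x = \<phi> k \<mu> + slope n b \<phi> k \<mu> * (x - b k \<mu>)) \<and>
     (\<forall>x. F \<mu> (x + 1) = F \<mu> x + 1) \<and>
     is_lift (F \<mu>) (f \<mu>))"

end

theory Submission
  imports Defs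
begin

text \<open>Write \<open>a\<close> for the critical parameter and \<open>h\<close> for the deviation from it. Since the map at \<open>a\<close> is
conjugate to a rational rotation, \<open>F a ^^ q\<close> is the translation by \<open>p\<close>
(\<open>conjugate_rational_rotation_return_map\<close>), so the return map \<open>G x = (F (a + h) ^^ q) x - p\<close> is the
identity at \<open>h = 0\<close>, and \<open>q * rotation_number (F (a + h)) - p\<close> is the mean displacement of \<open>G\<close>.

Away from the points whose orbit meets a corner, \<open>G x - x = h * g x + O(h\<^sup>2)\<close>, where \<open>g\<close> is the
derivative of \<open>F \<mu> ^^ q\<close> in the parameter at \<open>a\<close> (\<open>variation\<close>, \<open>iterate_expansion\<close>). Transversality makes
\<open>g\<close> positive, and even gives \<open>c * \<bar>h\<bar> \<le> \<bar>G x - x\<bar> \<le> C * \<bar>h\<bar>\<close> with the sign of \<open>h\<close> for all \<open>x\<close>, near the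
corners included (\<open>perturbation_bounds\<close>). Near a corner this holds because the map is there the maximum,
or the minimum, of the two adjacent affine pieces, and both pieces move in the same direction.

So \<open>G\<close> is nearly the time \<open>h\<close> map of the flow with speed \<open>g\<close>. Let \<open>T x\<close> be the integral of \<open>1 / g\<close> from
\<open>0\<close> to \<open>x\<close>, the time that this flow takes. A step of \<open>G\<close> outside the bad set, a neighbourhood of radius
\<open>O(h)\<close> of finitely many points of the circle, changes \<open>T\<close> by \<open>h + O(h\<^sup>2)\<close>. Inside the bad set only an
error \<open>O(h)\<close> is available, but a lap visits it a bounded number of times. Rather than by counting visits,
this is exploited by adding to \<open>T\<close>, or subtracting from it, a multiple of a monotone function that grows
with slope at least \<open>1\<close> in the bad set. The resulting functions gain at least, respectively at most,
\<open>h + O(h\<^sup>2)\<close> at every step for \<open>h > 0\<close>, and symmetrically for \<open>h < 0\<close>, while their growth per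
lap is \<open>T 1 + O(h)\<close>. Comparing gains along an orbit gives
\<open>T 1 * (q * rotation_number (F (a + h)) - p) = h + O(h\<^sup>2)\<close> (\<open>drift_estimate\<close>), so that the slope of
the rotation number at \<open>a\<close> is \<open>1 / (q * T 1)\<close>.\<close>

section \<open>Rotation numbers of degree one maps\<close>

definition degree_one :: "(real \<Rightarrow> real) \<Rightarrow> bool" where
  "degree_one F \<longleftrightarrow> strict_mono F \<and> (\<forall>x. F (x + 1) = F x + 1)"

lemma degree_one_add_int:
  assumes "\<forall>x. F (x + 1) = F x + (t::real)"
  shows "F (x + of_int m) = F x + of_int m * t"
proof (induction m rule: int_induct[where k = 0])
  case base
  then show ?case by simp
next
  case (step1 i)
  then show ?case
    using assms[rule_format, of "x + of_int i"] by (simp add: algebra_simps)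
next
  case (step2 i)
  then show ?case
    using assms[rule_format, of "x + of_int (i - 1)"] by (simp add: algebra_simps)
qed

lemma degree_one_int:
  assumes "degree_one F"
  shows "F (x + of_int m) = F x + of_int m"
  using degree_one_add_int[of F 1 x m] assms by (simp add: degree_one_def)

lemma degree_one_funpow:
  assumes "degree_one F"
  shows "degree_one (F ^^ m)"
proof (induction m)
  case 0
  then show ?case by (simp add: degree_one_def strict_mono_def)
next
  case (Suc m)
  then show ?case using assms by (auto simp: degree_one_def strict_mono_def)
qed

text \<open>The displacement has period \<open>1\<close>, so it suffices to compare points less than \<open>1\<close> apart, and for these
monotonicity suffices.\<close>

lemma degree_one_displacement:
  assumes "degree_one F"
  shows "\<bar>(F x - x) - (F y - y)\<bar> \<le> 1"
proof -
  define m where "m = \<lfloor>x - y\<rfloor>"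
  have m: "y + of_int m \<le> x" "x < y + of_int (m + 1)"
    unfolding m_def by linarith+
  have mono: "F u \<le> F v" if "u \<le> v" for u v
    using assms that by (metis degree_one_def strict_mono_less_eq)
  have "F (y + of_int m) \<le> F x" "F x \<le> F (y + of_int (m + 1))"
    using m by (auto intro!: mono)
  then have "F y + of_int m \<le> F x" "F x \<le> F y + of_int m + 1"
    by (simp_all only: degree_one_int[OF assms])
  then show ?thesis using m by (simp add: abs_le_iff)
qed

text \<open>By the previous bound the orbit \<open>a m\<close> of \<open>0\<close> is additive in \<open>m\<close> up to an error \<open>1\<close>. Computing
\<open>a (m * k)\<close> as \<open>m\<close> blocks of length \<open>k\<close> and as \<open>k\<close> blocks of length \<open>m\<close> shows that \<open>a m / m\<close> is a Cauchy sequence.\<close>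

lemma rotation_limit_exists:
  assumes "degree_one F"
  shows "\<exists>r. \<forall>x. (\<lambda>m. ((F ^^ m) x - x) / real m) \<longlonglongrightarrow> r"
proof -
  define a where "a m = (F ^^ m) 0" for m
  have step: "\<bar>a (m + k) - a m - a k\<bar> \<le> 1" for m k
    using degree_one_displacement[OF degree_one_funpow[OF assms, of m], of "a k" 0]
    by (simp add: a_def funpow_add)
  have mult: "\<bar>a (m * k) - m * a k\<bar> \<le> m" for m k
  proof (induction m)
    case 0
    then show ?case by (simp add: a_def)
  next
    case (Suc m)
    show ?case using Suc step[of k "m * k"] by (simp add: algebra_simps abs_le_iff)
  qed
  have near: "\<bar>a m / m - a k / k\<bar> \<le> 1 / m + 1 / k" if "m > 0" "k > 0" for m k :: nat
  proof -
    have "\<bar>m * a k - k * a m\<bar> \<le> real m + real k"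
      using mult[of m k] mult[of k m] by (simp add: mult.commute abs_le_iff)
    moreover have "a m / m - a k / k = (k * a m - m * a k) / (m * k)"
      using that by (simp add: field_simps)
    moreover have "1 / m + 1 / k = (real m + real k) / (m * k)"
      using that by (simp add: field_simps)
    ultimately show ?thesis
      using that by (simp add: abs_minus_commute divide_right_mono)
  qed
  have "Cauchy (\<lambda>m. a m / m)"
  proof (rule metric_CauchyI)
    fix e :: real assume "e > 0"
    then obtain N :: nat where N: "N > 2 / e" "N > 0"
      by (metis dual_order.strict_trans gr0I of_nat_0_less_iff reals_Archimedean2 zero_less_divide_iff zero_less_numeral)
    have "dist (a m / m) (a k / k) < e" if "m \<ge> N" "k \<ge> N" for m k :: nat
    proof -
      have "1 / real j < e / 2" if "j \<ge> N" for j
      proof -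
        have "2 / e < j" using that N by simp
        then have "2 < e * j" using \<open>e > 0\<close> by (simp add: field_simps)
        moreover have "j > 0" using that N by simp
        ultimately show ?thesis by (simp add: field_simps)
      qed
      from this[OF that(1)] this[OF that(2)] near[of m k] show ?thesis
        using that N by (simp add: dist_real_def)
    qed
    then show "\<exists>M. \<forall>m\<ge>M. \<forall>n\<ge>M. dist (a m / m) (a n / n) < e" by blast
  qed
  then obtain r where r: "(\<lambda>m. a m / m) \<longlonglongrightarrow> r"
    using Cauchy_convergent convergent_def by blast
  have "(\<lambda>m. ((F ^^ m) x - x) / real m) \<longlonglongrightarrow> r" for x
  proof -
    have "(\<lambda>m. ((F ^^ m) x - x - a m) / m) \<longlonglongrightarrow> 0"
    proof (rule Lim_null_comparison)
      show "\<forall>\<^sub>F m in sequentially. norm (((F ^^ m) x - x - a m) / m) \<le> 1 / real m"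
      proof (rule always_eventually, rule allI)
        fix m
        show "norm (((F ^^ m) x - x - a m) / m) \<le> 1 / real m"
          using degree_one_displacement[OF degree_one_funpow[OF assms, of m], of x 0]
          by (simp add: a_def divide_right_mono)
      qed
      show "(\<lambda>m. 1 / real m) \<longlonglongrightarrow> 0" by (rule lim_1_over_n)
    qed
    from tendsto_add[OF this r] show ?thesis by (simp add: diff_divide_distrib)
  qed
  then show ?thesis by blast
qed

lemma rotation_number_limit:
  assumes "degree_one F"
  shows "(\<lambda>m. ((F ^^ m) x - x) / real m) \<longlonglongrightarrow> rotation_number F"
proof -
  have "\<exists>!r. \<forall>x. (\<lambda>m. ((F ^^ m) x - x) / real m) \<longlonglongrightarrow> r"
    using rotation_limit_exists[OF assms] LIMSEQ_unique by blast
  from theI'[OF this] show ?thesis unfolding rotation_number_def by blast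
qed

lemma funpow_return_map:
  assumes "degree_one F"
  shows "((\<lambda>x. (F ^^ q) x - of_int p) ^^ m) x = (F ^^ (q * m)) x - of_int (p * int m)"
proof (induction m)
  case 0
  then show ?case by simp
next
  case (Suc m)
  have "(F ^^ q) ((F ^^ (q * m)) x + of_int (- (p * int m)))
      = (F ^^ q) ((F ^^ (q * m)) x) + of_int (- (p * int m))"
    by (rule degree_one_int[OF degree_one_funpow[OF assms]])
  then show ?case using Suc.IH by (simp add: funpow_add distrib_left)
qed

lemma return_map_limit:
  assumes "degree_one F" "q > 0"
  shows "(\<lambda>m. (((\<lambda>x. (F ^^ q) x - of_int p) ^^ m) x - x) / real m)
    \<longlonglongrightarrow> real q * rotation_number F - of_int p"
proof -
  have "filterlim (\<lambda>m. q * m) sequentially sequentially"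
    using \<open>q > 0\<close> by (simp add: mult_nat_left_at_top)
  from filterlim_compose[OF rotation_number_limit[OF assms(1), of x] this]
  have "(\<lambda>m. real q * (((F ^^ (q * m)) x - x) / real (q * m)) - of_int p)
      \<longlonglongrightarrow> real q * rotation_number F - of_int p"
    by (intro tendsto_intros)
  then show ?thesis
  proof (rule Lim_transform_eventually)
    show "\<forall>\<^sub>F m in sequentially. real q * (((F ^^ (q * m)) x - x) / real (q * m)) - of_int p
       = (((\<lambda>x. (F ^^ q) x - of_int p) ^^ m) x - x) / real m"
      using eventually_gt_at_top[of 0]
    proof eventually_elim
      case (elim m)
      then show ?case
        using \<open>q > 0\<close> by (simp add: funpow_return_map[OF assms(1)] field_simps)
    qed
  qed
qed

text \<open>A function \<open>T\<close> at bounded distance from the linear function of slope \<open>t\<close> serves as a measuring device: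
a gain of \<open>\<delta>\<close> at each step adds up along the orbit of \<open>0\<close> and forces \<open>t * \<theta> \<ge> \<delta>\<close>. Corrections of
either sign can be added to such a \<open>T\<close>.\<close>

lemma drift_lower_bound:
  fixes G T :: "real \<Rightarrow> real"
  assumes lim: "(\<lambda>m. ((G ^^ m) 0 - 0) / real m) \<longlonglongrightarrow> \<theta>"
    and T: "\<And>x. \<bar>T x - t * x\<bar> \<le> M"
    and inc: "\<And>x. T (G x) \<ge> T x + \<delta>"
  shows "\<delta> \<le> t * \<theta>"
proof -
  have it: "T ((G ^^ m) 0) \<ge> T 0 + m * \<delta>" for m
  proof (induction m)
    case (Suc m)
    then show ?case using inc[of "(G ^^ m) 0"] by (simp add: algebra_simps)
  qed simp
  have "\<delta> - (M - T 0) / m \<le> t * (((G ^^ m) 0 - 0) / m)" if "m > 0" for m :: nat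
  proof -
    have "m * \<delta> - (M - T 0) \<le> t * (G ^^ m) 0"
      using it[of m] T[of "(G ^^ m) 0"] by (simp add: abs_le_iff)
    then have "(m * \<delta> - (M - T 0)) / m \<le> t * (G ^^ m) 0 / m"
      by (rule divide_right_mono) simp
    then show ?thesis using that by (simp add: diff_divide_distrib)
  qed
  moreover have "(\<lambda>m. \<delta> - (M - T 0) / real m) \<longlonglongrightarrow> \<delta> - 0"
    by (intro tendsto_intros lim_const_over_n)
  moreover have "(\<lambda>m. t * (((G ^^ m) 0 - 0) / real m)) \<longlonglongrightarrow> t * \<theta>"
    by (intro tendsto_intros lim)
  ultimately have "\<delta> - 0 \<le> t * \<theta>"
    by (intro LIMSEQ_le) (auto intro!: exI[of _ 1])
  then show ?thesis by simp
qed

lemma drift_upper_bound: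
  fixes G T :: "real \<Rightarrow> real"
  assumes "(\<lambda>m. ((G ^^ m) 0 - 0) / real m) \<longlonglongrightarrow> \<theta>"
    and T: "\<And>x. \<bar>T x - t * x\<bar> \<le> M"
    and inc: "\<And>x. T (G x) \<le> T x + \<delta>"
  shows "t * \<theta> \<le> \<delta>"
proof -
  have "- T x + - \<delta> \<le> - T (G x)" for x using inc[of x] by simp
  moreover have "\<bar>- T x - - t * x\<bar> \<le> M" for x using T[of x] by (simp add: abs_minus_commute)
  ultimately show ?thesis
    using drift_lower_bound[OF assms(1), of "\<lambda>x. - T x" "- t" M "- \<delta>"] by simp
qed

section \<open>Maps conjugate to a rational rotation\<close>

lemma lift_funpow:
  assumes "is_lift F f"
  shows "(f ^^ m) (circle_of x) = circle_of ((F ^^ m) x)"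
  using assms by (induction m) (auto simp: is_lift_def)

lemma is_lift_degree_one: "is_lift F f \<Longrightarrow> degree_one F"
  by (simp add: is_lift_def degree_one_def)

lemma rigid_rotation_circle_of: "rigid_rotation \<omega> (circle_of x) = circle_of (x + \<omega>)"
  by (simp add: rigid_rotation.abs_eq circle_of_def)

lemma rigid_rotation_funpow:
  "(rigid_rotation \<omega> ^^ m) (circle_of x) = circle_of (x + m * \<omega>)"
  by (induction m) (simp_all add: rigid_rotation_circle_of algebra_simps)

text \<open>A rational rotation has finite order, and conjugacy carries this over to \<open>f\<close>. For the lift this means
that the displacement of an iterate is integer valued, hence constant by continuity.\<close>

lemma conjugate_rational_rotation_finite_order:
  assumes lift: "is_lift F f"
    and "\<exists>\<omega>\<in>\<rat>. circle_conjugate f (rigid_rotation \<omega>)"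
  obtains m :: nat and c :: int where "m > 0" "\<And>x. (F ^^ m) x = x + of_int c"
proof -
  obtain \<omega> h h' where \<omega>: "\<omega> \<in> \<rat>" and hom: "homeomorphism UNIV UNIV h h'"
    and h: "h \<circ> f = rigid_rotation \<omega> \<circ> h"
    using assms(2) unfolding circle_conjugate_def by blast
  obtain a :: int and m :: nat where m: "m > 0" "\<omega> = a / m"
    using \<omega> by (auto elim!: Rats_cases') (metis of_int_of_nat_eq of_nat_0_less_iff zero_less_imp_eq_int)
  have hinv: "h' (h z) = z" for z using hom by (simp add: homeomorphism_def)
  have h_it: "h ((f ^^ k) z) = (rigid_rotation \<omega> ^^ k) (h z)" for k z
  proof (induction k)
    case (Suc k)
    have "h (f ((f ^^ k) z)) = rigid_rotation \<omega> (h ((f ^^ k) z))"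
      using h by (metis comp_apply)
    then show ?case using Suc by simp
  qed simp
  have rot_id: "(rigid_rotation \<omega> ^^ m) z = z" for z
  proof -
    obtain x where "z = circle_of x" using surj_circle_of by blast
    then show ?thesis using m by (simp add: rigid_rotation_funpow circle_of_eq_iff)
  qed
  have ints: "(F ^^ m) x - x \<in> \<int>" for x
    using h_it[of m "circle_of x"] rot_id hinv lift_funpow[OF lift, of m x]
    by (metis circle_of_eq_iff)
  have cont: "continuous_on UNIV (F ^^ k)" for k
  proof (induction k)
    case (Suc k)
    have "continuous_on UNIV F" using lift by (simp add: is_lift_def)
    then show ?case
      using Suc by (metis continuous_on_compose continuous_on_subset funpow.simps(2) subset_UNIV)
  qed (simp add: id_def)
  obtain d where d: "\<And>x. (F ^^ m) x - x = d"
  proof -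
    have "(\<lambda>x. (F ^^ m) x - x) constant_on UNIV"
    proof (rule continuous_discrete_range_constant)
      show "continuous_on UNIV (\<lambda>x. (F ^^ m) x - x)"
        by (intro continuous_intros cont)
      show "\<exists>e>0. \<forall>y. y \<in> UNIV \<and> (F ^^ m) y - y \<noteq> (F ^^ m) x - x \<longrightarrow>
                e \<le> norm ((F ^^ m) y - y - ((F ^^ m) x - x))" if "x \<in> UNIV" for x
      proof (intro exI[of _ 1] conjI allI impI)
        fix y assume "y \<in> UNIV \<and> (F ^^ m) y - y \<noteq> (F ^^ m) x - x"
        then have "((F ^^ m) y - y) - ((F ^^ m) x - x) \<in> \<int>"
          "((F ^^ m) y - y) - ((F ^^ m) x - x) \<noteq> 0"
          using ints by (auto intro: Ints_diff)
        then show "1 \<le> norm ((F ^^ m) y - y - ((F ^^ m) x - x))"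
          using Ints_nonzero_abs_ge1 by fastforce
      qed simp
    qed simp
    then show ?thesis using that by (auto simp: constant_on_def)
  qed
  have "d \<in> \<int>" using ints[of 0] d by metis
  then obtain c :: int where "d = of_int c" by (auto elim: Ints_cases)
  then have "(F ^^ m) x = x + of_int c" for x using d[of x] by simp
  with m show ?thesis using that by blast
qed

text \<open>A point that is moved keeps moving in the same direction and cannot come back.\<close>

lemma strict_mono_finite_order_id:
  fixes G :: "real \<Rightarrow> real"
  assumes mono: "strict_mono G" and "m > 0" and id: "\<And>x. (G ^^ m) x = x"
  shows "G x = x"
proof -
  have up: "(G ^^ Suc k) x > x" if "G x > x" for k
  proof (induction k)
    case (Suc k)
    then have "G x < G ((G ^^ Suc k) x)" using mono by (simp add: strict_mono_less)
    with that show ?case by simp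
  qed (use that in simp)
  have down: "(G ^^ Suc k) x < x" if "G x < x" for k
  proof (induction k)
    case (Suc k)
    then have "G x > G ((G ^^ Suc k) x)" using mono by (simp add: strict_mono_less)
    with that show ?case by simp
  qed (use that in simp)
  obtain k where "m = Suc k" using \<open>m > 0\<close> gr0_implies_Suc by blast
  then show ?thesis using up[of k] down[of k] id[of x] by (metis less_irrefl linorder_less_linear)
qed

text \<open>Finite order alone gives an iterate \<open>F ^^ m\<close> that is the translation by some integer \<open>c\<close>. The rotation number
identifies \<open>c / m\<close> with \<open>p / q\<close>, and \<open>p / q\<close> may fail to be in lowest terms. The map \<open>F ^^ q\<close> followed by the
translation by \<open>-p\<close> then has \<open>m\<close>-th iterate the identity, so it is the identity.\<close>

lemma conjugate_rational_rotation_return_map: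
  assumes lift: "is_lift F f"
    and conj: "\<exists>\<omega>\<in>\<rat>. circle_conjugate f (rigid_rotation \<omega>)"
    and q: "q > 0" and rot: "rotation_number F = of_int p / of_nat q"
  shows "(F ^^ q) x = x + of_int p"
proof -
  note deg = is_lift_degree_one[OF lift]
  obtain m :: nat and c :: int where m: "m > 0" and F: "\<And>x. (F ^^ m) x = x + of_int c"
    using conjugate_rational_rotation_finite_order[OF lift conj] by blast
  have "(\<lambda>k. (((\<lambda>x. (F ^^ m) x - of_int c) ^^ k) 0 - 0) / real k) \<longlonglongrightarrow> 0"
  proof -
    have "((\<lambda>x. (F ^^ m) x - of_int c) ^^ k) 0 = 0" for k
      by (induction k) (simp_all add: F)
    then show ?thesis by simp
  qed
  from LIMSEQ_unique[OF this return_map_limit[OF deg m, of c 0]]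
  have "real m * (of_int p / real q) = of_int c" by (simp add: rot)
  then have mp: "real m * of_int p = of_int c * real q" using q by (simp add: field_simps)
  define G where "G = (\<lambda>x. (F ^^ q) x - of_int p)"
  have "(G ^^ m) x = x" for x
  proof -
    have "((\<lambda>x. (F ^^ m) x - of_int c) ^^ q) x = x" by (induction q) (simp_all add: F)
    then have "(F ^^ (m * q)) x = x + of_int c * real q"
      by (simp add: funpow_return_map[OF deg])
    then show ?thesis
      unfolding G_def using mp by (simp add: funpow_return_map[OF deg] mult.commute)
  qed
  moreover have "strict_mono G"
    using degree_one_funpow[OF deg, of q] by (simp add: G_def degree_one_def strict_mono_def)
  ultimately have "G x = x" using strict_mono_finite_order_id[OF _ m] by blast
  then show ?thesis by (simp add: G_def)
qed

section \<open>Time measured by the limiting speed\<close>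

text \<open>The preimage in the line of a subset of the circle.\<close>

definition int_translates :: "real set \<Rightarrow> real set" where
  "int_translates A = (\<Union>s\<in>A. (\<lambda>x. s + x) ` \<int>)"

lemma int_translates_iff: "x \<in> int_translates A \<longleftrightarrow> (\<exists>s\<in>A. \<exists>z::int. x = s + of_int z)"
  by (auto simp: int_translates_def Ints_def)

lemma closed_int_translates: "finite A \<Longrightarrow> closed (int_translates A)"
  unfolding int_translates_def
  by (intro closed_UN ballI closed_translation) (auto intro: closed_Ints)

lemma countable_int_translates: "finite A \<Longrightarrow> countable (int_translates A)"
  unfolding int_translates_def Ints_def
  by (intro countable_UN countable_image) (auto intro: countable_finite)

text \<open>The limiting speed \<open>g\<close> of the return map is positive, and Lipschitz between finitely many points of the
circle at which it may jump.\<close>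

locale speed =
  fixes g :: "real \<Rightarrow> real" and A :: "real set" and c C L :: real
  assumes finite_A: "finite A"
    and c_pos: "c > 0" and L_nonneg: "L \<ge> 0"
    and periodic: "g (x + 1) = g x"
    and lower: "c \<le> g x" and upper: "g x \<le> C"
    and lipschitz: "closed_segment x y \<inter> int_translates A = {} \<Longrightarrow> \<bar>g x - g y\<bar> \<le> L * \<bar>x - y\<bar>"
begin

lemma g_pos: "g x > 0"
  using c_pos lower[of x] by linarith

lemma recip_bounds: "1 / C \<le> 1 / g x" "1 / g x \<le> 1 / c" "0 \<le> 1 / g x"
  using c_pos lower[of x] upper[of x] by (auto intro!: divide_left_mono mult_pos_pos)

lemma recip_lipschitz:
  assumes "closed_segment x y \<inter> int_translates A = {}"
  shows "\<bar>1 / g x - 1 / g y\<bar> \<le> L / c\<^sup>2 * \<bar>x - y\<bar>"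
proof -
  have "1 / g x - 1 / g y = (g y - g x) / (g x * g y)"
    using g_pos[of x] g_pos[of y] by (simp add: field_simps)
  then have "\<bar>1 / g x - 1 / g y\<bar> = \<bar>g x - g y\<bar> / (g x * g y)"
    using g_pos[of x] g_pos[of y] by (simp add: abs_minus_commute)
  also have "\<dots> \<le> \<bar>g x - g y\<bar> / c\<^sup>2"
    using lower[of x] lower[of y] c_pos
    by (intro divide_left_mono) (auto simp: power2_eq_square intro!: mult_mono mult_pos_pos g_pos)
  also have "\<dots> \<le> (L * \<bar>x - y\<bar>) / c\<^sup>2"
    using lipschitz[OF assms] by (intro divide_right_mono) auto
  finally show ?thesis by simp
qed

lemma recip_continuous: "continuous_on (- int_translates A) (\<lambda>x. 1 / g x)"
proof -
  have op: "open (- int_translates A)" using closed_int_translates[OF finite_A] by auto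
  have "isCont (\<lambda>x. 1 / g x) x" if x: "x \<in> - int_translates A" for x
  proof -
    obtain e where e: "e > 0" "ball x e \<subseteq> - int_translates A"
      using op x openE by blast
    have "((\<lambda>y. 1 / g y - 1 / g x) \<longlongrightarrow> 0) (at x)"
    proof (rule Lim_null_comparison)
      have "\<forall>\<^sub>F y in at x. y \<in> ball x e"
        using e by (intro eventually_at_in_open') auto
      then show "\<forall>\<^sub>F y in at x. norm (1 / g y - 1 / g x) \<le> L / c\<^sup>2 * \<bar>y - x\<bar>"
      proof eventually_elim
        case (elim y)
        then have "closed_segment y x \<subseteq> ball x e"
          using e by (intro closed_segment_subset) auto
        then have "closed_segment y x \<inter> int_translates A = {}" using e by blast
        from recip_lipschitz[OF this] show ?case by simp
      qed
      have "((\<lambda>y. L / c\<^sup>2 * \<bar>y - x\<bar>) \<longlongrightarrow> L / c\<^sup>2 * \<bar>x - x\<bar>) (at x)"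
        by (intro tendsto_intros)
      then show "((\<lambda>y. L / c\<^sup>2 * \<bar>y - x\<bar>) \<longlongrightarrow> 0) (at x)" by simp
    qed
    then show ?thesis unfolding isCont_def by (rule LIM_zero_cancel)
  qed
  then show ?thesis by (simp add: continuous_at_imp_continuous_on)
qed

lemma recip_integrable: "(\<lambda>x. 1 / g x) integrable_on {x..y}"
proof (rule measurable_bounded_by_integrable_imp_integrable[where g = "\<lambda>_. 1 / c"])
  have "(\<lambda>x. 1 / g x) \<in> borel_measurable borel"
    using countable_int_translates[OF finite_A] recip_continuous
    by (rule borel_measurable_continuous_countable_exceptions)
  then have "(\<lambda>x. 1 / g x) \<in> borel_measurable lebesgue"
    by (intro measurable_completion) simp
  then show "(\<lambda>x. 1 / g x) \<in> borel_measurable (lebesgue_on {x..y})"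
    by (rule measurable_restrict_space1)
  show "norm (1 / g t) \<le> 1 / c" for t
    using recip_bounds[of t] by simp
qed auto

text \<open>The time that the flow with speed \<open>g\<close> takes from \<open>0\<close> to \<open>x\<close>. One of the two integrals is over an empty
or degenerate interval; the other one has the sign of \<open>x\<close>.\<close>

definition clock :: "real \<Rightarrow> real" where
  "clock x = integral {0..x} (\<lambda>t. 1 / g t) - integral {x..0} (\<lambda>t. 1 / g t)"

lemma clock_increment:
  assumes "x \<le> y"
  shows "clock y - clock x = integral {x..y} (\<lambda>t. 1 / g t)"
proof -
  note comb = Henstock_Kurzweil_Integration.integral_combine[OF _ _ recip_integrable]
  have zero: "integral {u..v} (\<lambda>t. 1 / g t) = 0" if "v \<le> u" for u v
    using that by (cases "u = v") auto
  consider "0 \<le> x" | "x \<le> 0" "0 \<le> y" | "y \<le> 0" using assms by linarith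
  then show ?thesis
  proof cases
    case 1
    then show ?thesis using comb[of 0 x y] assms zero[of 0 x] zero[of 0 y] by (simp add: clock_def)
  next
    case 2
    then show ?thesis using comb[of x 0 y] zero[of 0 y] zero[of x 0] by (simp add: clock_def)
  next
    case 3
    then show ?thesis using comb[of x y 0] assms zero[of x 0] zero[of y 0] by (simp add: clock_def)
  qed
qed

lemma clock_increment_bounds:
  assumes "x \<le> y"
  shows "(y - x) / C \<le> clock y - clock x" "clock y - clock x \<le> (y - x) / c" "clock x \<le> clock y"
proof -
  have const: "integral {x..y} (\<lambda>_. k) = k * (y - x)" for k :: real
    using assms integral_const_real[of k x y] by simp
  have "integral {x..y} (\<lambda>_. 1 / C) \<le> integral {x..y} (\<lambda>t. 1 / g t)"
    by (intro integral_le recip_integrable recip_bounds) auto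
  then show "(y - x) / C \<le> clock y - clock x"
    unfolding const clock_increment[OF assms] by simp
  have "integral {x..y} (\<lambda>t. 1 / g t) \<le> integral {x..y} (\<lambda>_. 1 / c)"
    by (intro integral_le recip_integrable recip_bounds) auto
  then show "clock y - clock x \<le> (y - x) / c"
    unfolding const clock_increment[OF assms] by simp
  have "integral {x..y} (\<lambda>_. 0) \<le> integral {x..y} (\<lambda>t. 1 / g t)"
    by (intro integral_le recip_integrable recip_bounds) auto
  then show "clock x \<le> clock y"
    using clock_increment[OF assms] by simp
qed

lemma clock_linearization_le:
  assumes "x \<le> y" "z \<in> {x, y}" and avoid: "closed_segment x y \<inter> int_translates A = {}"
  shows "\<bar>clock y - clock x - (y - x) / g z\<bar> \<le> L / c\<^sup>2 * (y - x)\<^sup>2"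
proof -
  define B where "B = L / c\<^sup>2 * (y - x)"
  have near: "\<bar>1 / g t - 1 / g z\<bar> \<le> B" if "t \<in> {x..y}" for t
  proof -
    have "closed_segment t z \<subseteq> closed_segment x y"
      using that assms(1,2) by (auto simp: closed_segment_eq_real_ivl)
    then have "\<bar>1 / g t - 1 / g z\<bar> \<le> L / c\<^sup>2 * \<bar>t - z\<bar>"
      using avoid by (intro recip_lipschitz) blast
    also have "\<dots> \<le> B" unfolding B_def
      using that assms(1,2) L_nonneg by (intro mult_left_mono) auto
    finally show ?thesis .
  qed
  have "integral {x..y} (\<lambda>t. 1 / g t) \<le> integral {x..y} (\<lambda>_. 1 / g z + B)"
    using near by (intro integral_le recip_integrable) (auto simp: abs_le_iff algebra_simps)
  moreover have "integral {x..y} (\<lambda>_. 1 / g z - B) \<le> integral {x..y} (\<lambda>t. 1 / g t)"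
    using near by (intro integral_le recip_integrable) (auto simp: abs_le_iff algebra_simps)
  ultimately have "\<bar>clock y - clock x - (y - x) / g z\<bar> \<le> B * (y - x)"
    using assms(1) by (simp add: clock_increment abs_le_iff algebra_simps)
  then show ?thesis unfolding B_def by (simp add: power2_eq_square mult.assoc)
qed

text \<open>Reading the speed at either endpoint of a step is accurate to second order in the length of the step,
as long as the step crosses no jump. The step may go in either direction.\<close>

lemma clock_linearization:
  assumes "closed_segment x y \<inter> int_translates A = {}"
  shows "\<bar>clock y - clock x - (y - x) / g x\<bar> \<le> L / c\<^sup>2 * (y - x)\<^sup>2"
proof (cases "x \<le> y")
  case True
  then show ?thesis using clock_linearization_le[of x y x] assms by simp
next
  case False
  have "\<bar>clock x - clock y - (x - y) / g x\<bar> \<le> L / c\<^sup>2 * (x - y)\<^sup>2"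
    using False assms by (intro clock_linearization_le) (auto simp: closed_segment_commute)
  moreover have "clock x - clock y - (x - y) / g x = - (clock y - clock x - (y - x) / g x)"
    by (simp add: diff_divide_distrib)
  ultimately show ?thesis by (simp only: abs_minus_cancel power2_commute[of x y])
qed

lemma clock_shift: "clock (x + 1) = clock x + clock 1"
proof -
  have shift: "clock (v + 1) - clock (u + 1) = clock v - clock u" if "u \<le> v" for u v
    using that integral_shift_real_ivl[of "u + 1" 1 "v + 1" "\<lambda>t. 1 / g t"]
    by (simp add: clock_increment periodic)
  have "clock 0 = 0" by (simp add: clock_def)
  with shift[of 0 x] shift[of x 0] show ?thesis by (cases "0 \<le> x") auto
qed

lemma clock_1_pos: "clock 1 > 0"
proof -
  have "C > 0" using lower[of 0] upper[of 0] c_pos by linarith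
  moreover have "clock 0 = 0" by (simp add: clock_def)
  ultimately have "0 < (1 - 0) / C" "(1 - 0) / C \<le> clock 1"
    using clock_increment_bounds(1)[of 0 1] by auto
  then show ?thesis by linarith
qed

lemma clock_near_linear: "\<bar>clock x - clock 1 * x\<bar> \<le> clock 1"
proof -
  define m where "m = \<lfloor>x\<rfloor>"
  have m: "of_int m \<le> x" "x \<le> of_int (m + 1)" unfolding m_def by linarith+
  have "clock (of_int k) = of_int k * clock 1" for k
    using degree_one_add_int[of clock "clock 1" 0 k] clock_shift by (simp add: clock_def)
  then have "of_int m * clock 1 \<le> clock x" "clock x \<le> of_int (m + 1) * clock 1"
    using clock_increment_bounds(3)[OF m(1)] clock_increment_bounds(3)[OF m(2)] by metis+
  then have "of_int m * clock 1 \<le> clock x" "clock x \<le> of_int m * clock 1 + clock 1"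
    by (simp_all add: algebra_simps)
  moreover have "of_int m * clock 1 \<le> x * clock 1" "x * clock 1 \<le> of_int (m + 1) * clock 1"
    using m clock_1_pos by (auto intro!: mult_right_mono)
  ultimately show ?thesis by (simp add: abs_le_iff algebra_simps)
qed

end

section \<open>Ramps near finitely many points of the circle\<close>

text \<open>A staircase that rises with slope \<open>1\<close> in the \<open>\<delta>\<close>-neighbourhoods of the points \<open>s + k\<close>, for integers \<open>k\<close>,
and is constant elsewhere. The summand \<open>1 / 2\<close> makes \<open>s + k\<close> the integer translate of \<open>s\<close> nearest to \<open>x\<close>.\<close>

definition ramp :: "real \<Rightarrow> real \<Rightarrow> real \<Rightarrow> real" where
  "ramp \<delta> s x = (let k = of_int \<lfloor>x - s + 1 / 2\<rfloor>
     in 2 * \<delta> * k + max (- \<delta>) (min \<delta> (x - s - k)))"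

lemma ramp_mono:
  assumes "\<delta> > 0" "x \<le> y"
  shows "ramp \<delta> s x \<le> ramp \<delta> s y"
proof -
  define i j where "i = \<lfloor>x - s + 1 / 2\<rfloor>" and "j = \<lfloor>y - s + 1 / 2\<rfloor>"
  have "i \<le> j" unfolding i_def j_def using assms by (intro floor_mono) auto
  show ?thesis
  proof (cases "i = j")
    case True
    then show ?thesis using assms unfolding ramp_def Let_def i_def[symmetric] j_def[symmetric] by auto
  next
    case False
    then have "real_of_int (i + 1) \<le> of_int j" using \<open>i \<le> j\<close> by (simp only: of_int_le_iff)
    then have "2 * \<delta> * of_int (i + 1) \<le> 2 * \<delta> * of_int j" using assms by (intro mult_left_mono) auto
    then have "2 * \<delta> * of_int i + \<delta> \<le> 2 * \<delta> * of_int j - \<delta>" by (simp add: algebra_simps)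
    moreover have "max (- \<delta>) (min \<delta> u) \<le> \<delta>" "- \<delta> \<le> max (- \<delta>) (min \<delta> u)" for u
      using assms by auto
    ultimately show ?thesis
      unfolding ramp_def Let_def i_def[symmetric] j_def[symmetric] by (smt (verit))
  qed
qed

lemma ramp_near_linear:
  assumes "\<delta> > 0"
  shows "\<bar>ramp \<delta> s x - 2 * \<delta> * x\<bar> \<le> 2 * \<delta> * (\<bar>s\<bar> + 1) + \<delta>"
proof -
  define k where "k = real_of_int \<lfloor>x - s + 1 / 2\<rfloor>"
  have "\<bar>k - x\<bar> \<le> \<bar>s\<bar> + 1" unfolding k_def by linarith
  then have "\<bar>2 * \<delta> * (k - x)\<bar> \<le> 2 * \<delta> * (\<bar>s\<bar> + 1)"
    using assms by (simp add: abs_mult)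
  moreover have "\<bar>max (- \<delta>) (min \<delta> (x - s - k))\<bar> \<le> \<delta>" using assms by auto
  moreover have "ramp \<delta> s x - 2 * \<delta> * x = 2 * \<delta> * (k - x) + max (- \<delta>) (min \<delta> (x - s - k))"
    unfolding ramp_def Let_def k_def[symmetric] by (simp add: right_diff_distrib)
  ultimately show ?thesis by linarith
qed

lemma ramp_near_corner:
  assumes "\<delta> < 1 / 2" "\<bar>x - (s + of_int z)\<bar> \<le> \<delta>"
  shows "ramp \<delta> s x = 2 * \<delta> * of_int z + (x - s - of_int z)"
proof -
  have "\<lfloor>x - s + 1 / 2\<rfloor> = z" using assms by (intro floor_unique) linarith+
  then show ?thesis using assms unfolding ramp_def Let_def by (auto simp: abs_le_iff)
qed

text \<open>The function \<open>R\<close> is the sum of the ramps of all points: where neighbourhoods overlap its slope only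
gets larger, and each point contributes \<open>2 * \<delta>\<close> to the growth per unit length.\<close>

lemma ramp_sum:
  fixes \<delta> :: real
  assumes "finite A" "0 < \<delta>" "\<delta> < 1 / 2"
  obtains R :: "real \<Rightarrow> real" and M where "mono R" "\<And>x. \<bar>R x - 2 * \<delta> * card A * x\<bar> \<le> M"
    "\<And>s x y. s \<in> int_translates A \<Longrightarrow> \<bar>x - s\<bar> \<le> \<delta> \<Longrightarrow> \<bar>y - s\<bar> \<le> \<delta> \<Longrightarrow> x \<le> y \<Longrightarrow> y - x \<le> R y - R x"
proof -
  define R where "R x = (\<Sum>s\<in>A. ramp \<delta> s x)" for x
  have "mono R" unfolding R_def by (intro monoI sum_mono ramp_mono assms)
  moreover have "\<bar>R x - 2 * \<delta> * card A * x\<bar> \<le> (\<Sum>s\<in>A. 2 * \<delta> * (\<bar>s\<bar> + 1) + \<delta>)" for x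
  proof -
    have "R x - 2 * \<delta> * card A * x = (\<Sum>s\<in>A. ramp \<delta> s x - 2 * \<delta> * x)"
      by (simp add: R_def sum_subtractf)
    also have "\<bar>\<dots>\<bar> \<le> (\<Sum>s\<in>A. \<bar>ramp \<delta> s x - 2 * \<delta> * x\<bar>)" by (rule sum_abs)
    also have "\<dots> \<le> (\<Sum>s\<in>A. 2 * \<delta> * (\<bar>s\<bar> + 1) + \<delta>)" by (intro sum_mono ramp_near_linear assms)
    finally show ?thesis .
  qed
  moreover have "y - x \<le> R y - R x"
    if s: "s \<in> int_translates A" and "\<bar>x - s\<bar> \<le> \<delta>" "\<bar>y - s\<bar> \<le> \<delta>" "x \<le> y" for s x y
  proof -
    obtain t z where t: "t \<in> A" "s = t + of_int z" using s int_translates_iff by auto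
    have "ramp \<delta> t y - ramp \<delta> t x = y - x"
      using that t assms by (simp add: ramp_near_corner[of _ _ _ z])
    moreover have "(\<Sum>s\<in>A - {t}. ramp \<delta> s x) \<le> (\<Sum>s\<in>A - {t}. ramp \<delta> s y)"
      by (intro sum_mono ramp_mono assms that)
    ultimately show ?thesis using t assms by (simp add: R_def sum.remove[of A t])
  qed
  ultimately show ?thesis using that by blast
qed

section \<open>The mean displacement of a slow map\<close>

context speed
begin

text \<open>Here \<open>\<sigma>\<close> is the direction of motion and \<open>e\<close> the size of the parameter. The measuring devices are
\<open>clock x + R x / c\<close> and \<open>clock x - R x / c\<close>, where \<open>R\<close> is a sum of ramps of radius \<open>2 * K * e\<close>. For a good step
the clock alone gives \<open>e\<close> up to \<open>O(e\<^sup>2)\<close>, and \<open>R\<close>, being monotone, moves in the direction of the motion. For a bad step the whole step lies in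
the range of a ramp, so \<open>R / c\<close> changes by at least \<open>(c * e) / c = e\<close>; this is enough for the sum, and it
outweighs the clock in the difference because the clock has slope at most \<open>1 / c\<close>. Since \<open>R\<close> grows by \<open>O(e)\<close> per
lap and \<open>\<theta>\<close> is itself \<open>O(e)\<close>, the correction costs only \<open>O(e\<^sup>2)\<close>.\<close>

lemma drift_estimate:
  fixes G :: "real \<Rightarrow> real" and e K \<sigma> \<theta> :: real
  assumes e: "0 < e" "2 * K * e < 1 / 2" and C: "0 < C" "C \<le> K" and \<sigma>: "\<sigma> \<in> {1, - 1}"
    and lim: "(\<lambda>m. ((G ^^ m) 0 - 0) / real m) \<longlonglongrightarrow> \<theta>"
    and step: "\<And>x. c * e \<le> \<sigma> * (G x - x) \<and> \<sigma> * (G x - x) \<le> C * e"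
    and far: "\<And>x. (\<And>s. s \<in> int_translates A \<Longrightarrow> \<bar>x - s\<bar> > K * e)
                \<Longrightarrow> \<bar>\<sigma> * (G x - x) - e * g x\<bar> \<le> K * e\<^sup>2"
  shows "\<bar>clock 1 * \<theta> - \<sigma> * e\<bar> \<le> (L / c\<^sup>2 * C\<^sup>2 + K / c + 4 * K * card A * C / c) * e\<^sup>2"
proof -
  \<comment> \<open>Twice the radius of the bad set: a step that starts in the bad set has length at most \<open>K * e\<close>.\<close>
  define \<delta> where "\<delta> = 2 * K * e"
  have \<delta>: "0 < \<delta>" "\<delta> < 1 / 2" using e C by (auto simp: \<delta>_def)
  obtain R M where R_mono: "mono R" and R_lin: "\<And>x. \<bar>R x - 2 * \<delta> * card A * x\<bar> \<le> M"
    and R_near: "\<And>s x y. s \<in> int_translates A \<Longrightarrow> \<bar>x - s\<bar> \<le> \<delta> \<Longrightarrow> \<bar>y - s\<bar> \<le> \<delta> \<Longrightarrow> x \<le> y \<Longrightarrow> y - x \<le> R y - R x"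
    using ramp_sum[OF finite_A \<delta>] by blast
  define E where "E = (L / c\<^sup>2 * C\<^sup>2 + K / c) * e\<^sup>2"
  have E_nonneg: "E \<ge> 0" using L_nonneg c_pos C by (simp add: E_def)
  define r where "r = 2 * \<delta> * card A"
  have r_nonneg: "r \<ge> 0" using \<delta> by (simp add: r_def)
  have key: "e - E \<le> \<sigma> * (clock (G x) - clock x) + \<sigma> * (R (G x) - R x) / c \<and>
             \<sigma> * (clock (G x) - clock x) - \<sigma> * (R (G x) - R x) / c \<le> e + E" for x
  proof -
    define y where "y = G x"
    note st = step[of x, folded y_def]
    have R_sgn: "0 \<le> \<sigma> * (R y - R x)"
      using \<sigma> st R_mono mult_pos_pos[OF c_pos e(1)] by (auto simp: mono_def)
    have clock_sgn: "0 \<le> \<sigma> * (clock y - clock x)" "\<sigma> * (clock y - clock x) \<le> \<sigma> * (y - x) / c"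
      using \<sigma> st clock_increment_bounds[of x y] clock_increment_bounds[of y x] mult_pos_pos[OF c_pos e(1)]
      by (auto simp: diff_divide_distrib)
    have dist: "\<bar>y - x\<bar> = \<sigma> * (y - x)"
      using \<sigma> st mult_pos_pos[OF c_pos e(1)] by auto
    show ?thesis
    proof (cases "\<exists>s\<in>int_translates A. \<bar>x - s\<bar> \<le> K * e")
      case True
      then obtain s where s: "s \<in> int_translates A" "\<bar>x - s\<bar> \<le> K * e" by blast
      have "C * e \<le> K * e" using C e by simp
      then have "\<bar>x - s\<bar> \<le> \<delta>" "\<bar>y - s\<bar> \<le> \<delta>" using s st dist unfolding \<delta>_def by linarith+
      then have "\<sigma> * (y - x) \<le> \<sigma> * (R y - R x)"
        using R_near[OF s(1), of x y] R_near[OF s(1), of y x] \<sigma> st mult_pos_pos[OF c_pos e(1)] by auto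
      then have *: "\<sigma> * (y - x) / c \<le> \<sigma> * (R y - R x) / c"
        using c_pos by (intro divide_right_mono) auto
      moreover have "e \<le> \<sigma> * (y - x) / c" using st c_pos by (simp add: field_simps)
      ultimately show ?thesis using clock_sgn E_nonneg e(1) unfolding y_def[symmetric] by linarith
    next
      case False
      then have f: "\<bar>\<sigma> * (y - x) - e * g x\<bar> \<le> K * e\<^sup>2"
        unfolding y_def by (intro far) force
      have "closed_segment x y \<inter> int_translates A = {}"
      proof (rule ccontr)
        assume "closed_segment x y \<inter> int_translates A \<noteq> {}"
        then obtain s where s: "s \<in> closed_segment x y" "s \<in> int_translates A" by blast
        have "\<bar>x - s\<bar> \<le> \<bar>y - x\<bar>" using s(1) by (auto simp: closed_segment_eq_real_ivl split: if_splits)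
        also have "\<dots> \<le> K * e" using st dist C e by (smt (verit) mult_right_mono)
        finally show False using False s(2) by blast
      qed
      from clock_linearization[OF this]
      have "\<bar>\<sigma> * (clock y - clock x - (y - x) / g x)\<bar> \<le> L / c\<^sup>2 * (y - x)\<^sup>2"
        using \<sigma> by auto
      also have "\<dots> \<le> L / c\<^sup>2 * (C * e)\<^sup>2"
      proof (rule mult_left_mono)
        have "\<bar>y - x\<bar>\<^sup>2 \<le> (C * e)\<^sup>2" using st dist by (intro power_mono) auto
        then show "(y - x)\<^sup>2 \<le> (C * e)\<^sup>2" by simp
      qed (use L_nonneg c_pos in auto)
      finally have 1: "\<bar>\<sigma> * (clock y - clock x) - \<sigma> * (y - x) / g x\<bar> \<le> L / c\<^sup>2 * C\<^sup>2 * e\<^sup>2"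
        by (simp add: algebra_simps power_mult_distrib)
      have "\<sigma> * (y - x) / g x - e = (\<sigma> * (y - x) - e * g x) / g x"
        using g_pos[of x] by (simp add: field_simps)
      then have "\<bar>\<sigma> * (y - x) / g x - e\<bar> = \<bar>\<sigma> * (y - x) - e * g x\<bar> / g x"
        using g_pos[of x] by simp
      also have "\<dots> \<le> K * e\<^sup>2 / c"
        using f lower[of x] c_pos by (intro frac_le) auto
      finally have "\<bar>\<sigma> * (clock y - clock x) - e\<bar> \<le> E"
        using 1 by (simp add: E_def distrib_right abs_le_iff)
      moreover have "0 \<le> \<sigma> * (R y - R x) / c" using R_sgn c_pos by simp
      ultimately show ?thesis unfolding y_def[symmetric] by linarith
    qed
  qed
  \<comment> \<open>The identity as measuring device gives a first, crude bound.\<close>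
  have \<theta>_bound: "0 \<le> \<sigma> * \<theta> \<and> \<sigma> * \<theta> \<le> C * e"
  proof -
    have ce: "0 \<le> c * e" using c_pos e by simp
    have id: "\<bar>x - 1 * x\<bar> \<le> 0" for x :: real by simp
    show ?thesis
    proof (cases "\<sigma> = 1")
      case True
      have "x + c * e \<le> G x" "G x \<le> x + C * e" for x using step[of x] True by auto
      from drift_lower_bound[OF lim id this(1)] drift_upper_bound[OF lim id this(2)]
      show ?thesis using ce True by simp
    next
      case False
      then have \<sigma>: "\<sigma> = - 1" using \<sigma> by simp
      have "x + (- (C * e)) \<le> G x" "G x \<le> x + (- (c * e))" for x using step[of x] \<sigma> by auto
      from drift_lower_bound[OF lim id this(1)] drift_upper_bound[OF lim id this(2)]
      show ?thesis using ce \<sigma> by simp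
    qed
  qed
  have lin: "\<bar>(clock x + \<tau> * R x / c) - (clock 1 + \<tau> * r / c) * x\<bar> \<le> clock 1 + M / c"
    if "\<tau> \<in> {1, - 1}" for \<tau> x
  proof -
    have "(clock x + \<tau> * R x / c) - (clock 1 + \<tau> * r / c) * x
        = (clock x - clock 1 * x) + \<tau> * ((R x - r * x) / c)"
      by (simp add: algebra_simps diff_divide_distrib)
    moreover have "\<bar>\<tau> * ((R x - r * x) / c)\<bar> \<le> M / c"
      using that R_lin[of x] c_pos by (auto simp: r_def abs_mult divide_right_mono)
    ultimately show ?thesis using clock_near_linear[of x] by linarith
  qed
  have main: "e - E \<le> \<sigma> * ((clock 1 + r / c) * \<theta>) \<and> \<sigma> * ((clock 1 - r / c) * \<theta>) \<le> e + E"
  proof (cases "\<sigma> = 1")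
    case True
    have "(clock x + 1 * R x / c) + (e - E) \<le> clock (G x) + 1 * R (G x) / c" for x
      using key[of x] True by (simp add: diff_divide_distrib)
    from drift_lower_bound[OF lim lin this]
    have "e - E \<le> (clock 1 + 1 * r / c) * \<theta>" by simp
    moreover have "clock (G x) + (- 1) * R (G x) / c \<le> (clock x + (- 1) * R x / c) + (e + E)" for x
      using key[of x] True by (simp add: diff_divide_distrib)
    from drift_upper_bound[OF lim lin this]
    have "(clock 1 + (- 1) * r / c) * \<theta> \<le> e + E" by simp
    ultimately show ?thesis using True by simp
  next
    case False
    then have \<sigma>: "\<sigma> = - 1" using \<sigma> by simp
    have "clock (G x) + 1 * R (G x) / c \<le> (clock x + 1 * R x / c) + (- (e - E))" for x
      using key[of x] \<sigma> by (simp add: diff_divide_distrib)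
    from drift_upper_bound[OF lim lin this]
    have "(clock 1 + 1 * r / c) * \<theta> \<le> - (e - E)" by simp
    moreover have "(clock x + (- 1) * R x / c) + (- (e + E)) \<le> clock (G x) + (- 1) * R (G x) / c" for x
      using key[of x] \<sigma> by (simp add: diff_divide_distrib)
    from drift_lower_bound[OF lim lin this]
    have "- (e + E) \<le> (clock 1 + (- 1) * r / c) * \<theta>" by simp
    ultimately show ?thesis using \<sigma> by simp
  qed
  have "\<sigma> * \<theta> * (r / c) \<le> C * e * (r / c)"
    using \<theta>_bound r_nonneg c_pos by (intro mult_right_mono) auto
  also have "C * e * (r / c) = 4 * K * card A * C / c * e\<^sup>2"
    by (simp add: r_def \<delta>_def power2_eq_square)
  finally have "\<bar>\<sigma> * (clock 1 * \<theta>) - e\<bar> \<le> E + 4 * K * card A * C / c * e\<^sup>2"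
    using main by (simp add: abs_le_iff algebra_simps)
  moreover have "\<bar>clock 1 * \<theta> - \<sigma> * e\<bar> = \<bar>\<sigma> * (clock 1 * \<theta>) - e\<bar>"
    using \<sigma> by auto
  ultimately show ?thesis by (simp add: E_def algebra_simps)
qed

end

section \<open>Expansions with quadratic error\<close>

text \<open>Such expansions are closed under the arithmetic operations, so they pass from the corners and their
images to the slopes and to the affine pieces.\<close>

definition second_order :: "(real \<Rightarrow> real) \<Rightarrow> real \<Rightarrow> real \<Rightarrow> bool" where
  "second_order f a d \<longleftrightarrow> (\<exists>K\<ge>0. \<forall>\<^sub>F h in nhds 0. \<bar>f (a + h) - f a - d * h\<bar> \<le> K * h\<^sup>2)"

lemma small_eventually: "0 < r \<Longrightarrow> \<forall>\<^sub>F h in nhds 0. \<bar>h\<bar> < (r::real)"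
  by (auto simp: eventually_nhds_metric dist_real_def)

lemma eventually_nhds_shift:
  "(\<forall>\<^sub>F h in nhds 0. P (a + h)) \<longleftrightarrow> (\<forall>\<^sub>F x in nhds (a::real). P x)"
  using eventually_filtermap[of P "\<lambda>h. a + h" "nhds 0"] filtermap_nhds_shift[of "- a" 0]
  by (simp add: add.commute)

lemma second_order_cong:
  assumes "second_order f a d" and eq: "\<forall>\<^sub>F x in nhds a. f x = g x"
  shows "second_order g a d"
proof -
  obtain K where "K \<ge> 0" and K: "\<forall>\<^sub>F h in nhds 0. \<bar>f (a + h) - f a - d * h\<bar> \<le> K * h\<^sup>2"
    using assms by (auto simp: second_order_def)
  have "f a = g a" using eq by (rule eventually_nhds_x_imp_x)
  have "\<forall>\<^sub>F h in nhds 0. f (a + h) = g (a + h)"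
    using eq by (simp add: eventually_nhds_shift[of "\<lambda>x. f x = g x"])
  then have "\<forall>\<^sub>F h in nhds 0. \<bar>g (a + h) - g a - d * h\<bar> \<le> K * h\<^sup>2"
    using K by eventually_elim (use \<open>f a = g a\<close> in simp)
  then show ?thesis using \<open>K \<ge> 0\<close> by (auto simp: second_order_def)
qed

lemma second_order_const: "second_order (\<lambda>_. k) a 0"
  by (auto simp: second_order_def intro!: exI[of _ 0])

lemma second_order_add:
  assumes "second_order f a d" "second_order g a e"
  shows "second_order (\<lambda>x. f x + g x) a (d + e)"
proof -
  obtain K where "K \<ge> 0" and K: "\<forall>\<^sub>F h in nhds 0. \<bar>f (a + h) - f a - d * h\<bar> \<le> K * h\<^sup>2"
    using assms by (auto simp: second_order_def)
  obtain J where "J \<ge> 0" and J: "\<forall>\<^sub>F h in nhds 0. \<bar>g (a + h) - g a - e * h\<bar> \<le> J * h\<^sup>2"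
    using assms by (auto simp: second_order_def)
  have "\<forall>\<^sub>F h in nhds 0. \<bar>(f (a + h) + g (a + h)) - (f a + g a) - (d + e) * h\<bar> \<le> (K + J) * h\<^sup>2"
    using K J by eventually_elim (simp add: algebra_simps abs_le_iff)
  then show ?thesis unfolding second_order_def using \<open>K \<ge> 0\<close> \<open>J \<ge> 0\<close>
    by (intro exI[of _ "K + J"]) auto
qed

lemma second_order_minus:
  assumes "second_order f a d"
  shows "second_order (\<lambda>x. - f x) a (- d)"
proof -
  have "\<bar>- f (a + h) - - f a - - d * h\<bar> = \<bar>f (a + h) - f a - d * h\<bar>" for h by simp
  then show ?thesis using assms unfolding second_order_def by simp
qed

lemma second_order_diff:
  assumes "second_order f a d" "second_order g a e"
  shows "second_order (\<lambda>x. f x - g x) a (d - e)"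
  using second_order_add[OF assms(1) second_order_minus[OF assms(2)]] by simp

lemma second_order_lipschitz:
  assumes "second_order f a d"
  obtains K where "K \<ge> 0" "\<forall>\<^sub>F h in nhds 0. \<bar>f (a + h) - f a\<bar> \<le> K * \<bar>h\<bar>"
proof -
  obtain K where "K \<ge> 0" and K: "\<forall>\<^sub>F h in nhds 0. \<bar>f (a + h) - f a - d * h\<bar> \<le> K * h\<^sup>2"
    using assms by (auto simp: second_order_def)
  have "\<forall>\<^sub>F h in nhds 0. \<bar>f (a + h) - f a\<bar> \<le> (\<bar>d\<bar> + K) * \<bar>h\<bar>"
    using K small_eventually[of 1, simplified]
  proof eventually_elim
    case (elim h)
    have "h\<^sup>2 = \<bar>h\<bar> * \<bar>h\<bar>" by (simp add: power2_eq_square)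
    also have "\<dots> \<le> 1 * \<bar>h\<bar>" using elim by (intro mult_right_mono) auto
    finally have "K * h\<^sup>2 \<le> K * \<bar>h\<bar>" using \<open>K \<ge> 0\<close> by (simp add: mult_left_mono)
    then have "\<bar>f (a + h) - f a - d * h\<bar> \<le> K * \<bar>h\<bar>" using elim by linarith
    moreover have "\<bar>d * h\<bar> = \<bar>d\<bar> * \<bar>h\<bar>" by (rule abs_mult)
    ultimately show ?case by (simp only: distrib_right)
  qed
  then show ?thesis using that[of "\<bar>d\<bar> + K"] \<open>K \<ge> 0\<close> by simp
qed

lemma second_order_has_derivative:
  assumes "second_order f a d"
  shows "(f has_field_derivative d) (at a)"
proof -
  obtain K where "K \<ge> 0" and K: "\<forall>\<^sub>F h in nhds 0. \<bar>f (a + h) - f a - d * h\<bar> \<le> K * h\<^sup>2"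
    using assms by (auto simp: second_order_def)
  have "((\<lambda>h. (f (a + h) - f a) / h - d) \<longlongrightarrow> 0) (at 0)"
  proof (rule Lim_null_comparison)
    have "\<forall>\<^sub>F h in at 0. h \<noteq> (0::real)" by (simp add: eventually_at_filter)
    with eventually_at_filter[THEN iffD2, OF eventually_mono[OF K]]
    have "\<forall>\<^sub>F h in at 0. \<bar>f (a + h) - f a - d * h\<bar> \<le> K * h\<^sup>2 \<and> h \<noteq> 0"
      by (auto simp: eventually_conj_iff)
    then show "\<forall>\<^sub>F h in at 0. norm ((f (a + h) - f a) / h - d) \<le> K * \<bar>h\<bar>"
    proof eventually_elim
      case (elim h)
      then have "(f (a + h) - f a) / h - d = (f (a + h) - f a - d * h) / h" by (simp add: field_simps)
      then have "\<bar>(f (a + h) - f a) / h - d\<bar> \<le> K * h\<^sup>2 / \<bar>h\<bar>"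
        using elim by (simp add: divide_right_mono)
      also have "\<dots> = K * \<bar>h\<bar>" using elim by (simp add: power2_eq_square field_simps)
      finally show ?case by simp
    qed
    have "((\<lambda>h. K * \<bar>h\<bar>) \<longlongrightarrow> K * \<bar>0\<bar>) (at (0::real))" by (intro tendsto_intros)
    then show "((\<lambda>h. K * \<bar>h\<bar>) \<longlongrightarrow> 0) (at (0::real))" by simp
  qed
  then show ?thesis unfolding DERIV_def by (rule LIM_zero_cancel)
qed

lemma second_order_isCont: "second_order f a d \<Longrightarrow> isCont f a"
  using second_order_has_derivative DERIV_isCont by blast

lemma second_order_deriv: "second_order f a d \<Longrightarrow> deriv f a = d"
  using second_order_has_derivative DERIV_imp_deriv by blast

lemma second_order_mult:
  assumes "second_order f a d" "second_order g a e"
  shows "second_order (\<lambda>x. f x * g x) a (d * g a + f a * e)"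
proof -
  obtain K where "K \<ge> 0" and K: "\<forall>\<^sub>F h in nhds 0. \<bar>f (a + h) - f a - d * h\<bar> \<le> K * h\<^sup>2"
    using assms by (auto simp: second_order_def)
  obtain J where "J \<ge> 0" and J: "\<forall>\<^sub>F h in nhds 0. \<bar>g (a + h) - g a - e * h\<bar> \<le> J * h\<^sup>2"
    using assms by (auto simp: second_order_def)
  obtain L where "L \<ge> 0" and L: "\<forall>\<^sub>F h in nhds 0. \<bar>g (a + h) - g a\<bar> \<le> L * \<bar>h\<bar>"
    using second_order_lipschitz[OF assms(2)] by blast
  define M where "M = K * (\<bar>g a\<bar> + L) + (\<bar>f a\<bar> + \<bar>d\<bar>) * J + \<bar>d * e\<bar>"
  have "\<forall>\<^sub>F h in nhds 0. \<bar>f (a + h) * g (a + h) - f a * g a - (d * g a + f a * e) * h\<bar> \<le> M * h\<^sup>2"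
    using K J L small_eventually[of 1, simplified]
  proof eventually_elim
    case (elim h)
    let ?r = "f (a + h) - f a - d * h" and ?t = "g (a + h) - g a - e * h"
    have "L * \<bar>h\<bar> \<le> L * 1" using \<open>L \<ge> 0\<close> elim by (intro mult_left_mono) auto
    then have g: "\<bar>g (a + h)\<bar> \<le> \<bar>g a\<bar> + L" using elim by linarith
    have "\<bar>d\<bar> * \<bar>h\<bar> \<le> \<bar>d\<bar> * 1" using elim by (intro mult_left_mono) auto
    then have fd: "\<bar>f a + d * h\<bar> \<le> \<bar>f a\<bar> + \<bar>d\<bar>"
      using abs_mult[of d h] abs_triangle_ineq[of "f a" "d * h"] by linarith
    have 1: "\<bar>?r * g (a + h)\<bar> \<le> (K * h\<^sup>2) * (\<bar>g a\<bar> + L)"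
      unfolding abs_mult using elim g \<open>K \<ge> 0\<close> by (intro mult_mono) auto
    have 2: "\<bar>(f a + d * h) * ?t\<bar> \<le> (\<bar>f a\<bar> + \<bar>d\<bar>) * (J * h\<^sup>2)"
      unfolding abs_mult[of "f a + d * h"] using elim fd by (intro mult_mono) auto
    have 3: "\<bar>d * e * h\<^sup>2\<bar> = \<bar>d * e\<bar> * h\<^sup>2" by (simp add: abs_mult)
    have "f (a + h) * g (a + h) - f a * g a - (d * g a + f a * e) * h
        = ?r * g (a + h) + (f a + d * h) * ?t + d * e * h\<^sup>2"
      by (simp add: algebra_simps power2_eq_square)
    also have "\<bar>\<dots>\<bar> \<le> (K * h\<^sup>2) * (\<bar>g a\<bar> + L) + (\<bar>f a\<bar> + \<bar>d\<bar>) * (J * h\<^sup>2) + \<bar>d * e\<bar> * h\<^sup>2"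
      using 1 2 3 by linarith
    finally show ?case by (simp add: M_def algebra_simps)
  qed
  moreover have "M \<ge> 0" using \<open>K \<ge> 0\<close> \<open>J \<ge> 0\<close> \<open>L \<ge> 0\<close> by (simp add: M_def)
  ultimately show ?thesis unfolding second_order_def by blast
qed

lemma second_order_inverse:
  assumes "second_order g a e" and nz: "g a \<noteq> 0"
  shows "second_order (\<lambda>x. 1 / g x) a (- e / (g a)\<^sup>2)"
proof -
  obtain J where "J \<ge> 0" and J: "\<forall>\<^sub>F h in nhds 0. \<bar>g (a + h) - g a - e * h\<bar> \<le> J * h\<^sup>2"
    using assms by (auto simp: second_order_def)
  obtain L where "L \<ge> 0" and L: "\<forall>\<^sub>F h in nhds 0. \<bar>g (a + h) - g a\<bar> \<le> L * \<bar>h\<bar>"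
    using second_order_lipschitz[OF assms(1)] by blast
  define M where "M = (\<bar>g a\<bar> * J + \<bar>e\<bar> * L) / (\<bar>g a\<bar> ^ 3 / 2)"
  have "\<bar>g a\<bar> / (2 * (L + 1)) > 0" using nz \<open>L \<ge> 0\<close> by simp
  from small_eventually[OF this] J L
  have "\<forall>\<^sub>F h in nhds 0. \<bar>1 / g (a + h) - 1 / g a - (- e / (g a)\<^sup>2) * h\<bar> \<le> M * h\<^sup>2"
  proof eventually_elim
    case (elim h)
    let ?t = "g (a + h) - g a - e * h"
    have "\<bar>h\<bar> * (2 * (L + 1)) < \<bar>g a\<bar>"
      using elim(1) \<open>L \<ge> 0\<close> by (simp add: pos_less_divide_eq)
    then have "2 * (L * \<bar>h\<bar>) \<le> \<bar>g a\<bar>" by (simp add: algebra_simps)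
    then have half: "\<bar>g a\<bar> / 2 \<le> \<bar>g (a + h)\<bar>" using elim by linarith
    then have nz': "g (a + h) \<noteq> 0" using nz by auto
    have "1 / g (a + h) - 1 / g a - (- e / (g a)\<^sup>2) * h
        = (- g a * ?t + e * h * (g (a + h) - g a)) / (g (a + h) * (g a)\<^sup>2)"
      using nz nz' by (simp add: field_simps power2_eq_square)
    then have "\<bar>1 / g (a + h) - 1 / g a - (- e / (g a)\<^sup>2) * h\<bar>
        = \<bar>- g a * ?t + e * h * (g (a + h) - g a)\<bar> / (\<bar>g (a + h)\<bar> * \<bar>g a\<bar>\<^sup>2)"
      by (simp add: abs_mult)
    also have "\<dots> \<le> ((\<bar>g a\<bar> * J + \<bar>e\<bar> * L) * h\<^sup>2) / (\<bar>g a\<bar> / 2 * \<bar>g a\<bar>\<^sup>2)"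
    proof (rule frac_le)
      have 1: "\<bar>- g a * ?t\<bar> \<le> \<bar>g a\<bar> * (J * h\<^sup>2)"
        unfolding abs_mult abs_minus_cancel using elim by (intro mult_left_mono) auto
      have "\<bar>e * h * (g (a + h) - g a)\<bar> \<le> \<bar>e\<bar> * \<bar>h\<bar> * (L * \<bar>h\<bar>)"
        unfolding abs_mult using elim by (intro mult_left_mono) auto
      also have "\<dots> = \<bar>e\<bar> * L * h\<^sup>2" by (simp add: power2_eq_square)
      finally show "\<bar>- g a * ?t + e * h * (g (a + h) - g a)\<bar> \<le> (\<bar>g a\<bar> * J + \<bar>e\<bar> * L) * h\<^sup>2"
        using 1 abs_triangle_ineq[of "- g a * ?t" "e * h * (g (a + h) - g a)"]
        by (simp only: distrib_right mult.assoc)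
      show "\<bar>g a\<bar> / 2 * \<bar>g a\<bar>\<^sup>2 \<le> \<bar>g (a + h)\<bar> * \<bar>g a\<bar>\<^sup>2"
        using half by (intro mult_right_mono) auto
    qed (use nz \<open>J \<ge> 0\<close> \<open>L \<ge> 0\<close> in auto)
    also have "\<bar>g a\<bar> / 2 * \<bar>g a\<bar>\<^sup>2 = \<bar>g a\<bar> ^ 3 / 2" by (simp add: power2_eq_square power3_eq_cube)
    finally show ?case unfolding M_def by (simp only: times_divide_eq_left)
  qed
  moreover have "M \<ge> 0" using \<open>J \<ge> 0\<close> \<open>L \<ge> 0\<close> by (simp add: M_def)
  ultimately show ?thesis unfolding second_order_def by blast
qed

text \<open>Subtracting the tangent leaves a function whose derivative is \<open>O(h)\<close> on the segment from \<open>a\<close> to \<open>a + h\<close>,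
because the derivative of \<open>g\<close> is differentiable at \<open>a\<close>.\<close>

lemma second_order_C2:
  assumes "C2_on I g" "open I" "a \<in> I"
  shows "second_order g a (deriv g a)"
proof -
  have dg: "(g has_field_derivative deriv g x) (at x)" if "x \<in> I" for x
    using assms that DERIV_deriv_iff_real_differentiable by (auto simp: C2_on_def)
  obtain D where D: "(deriv g has_field_derivative D) (at a)"
    using assms(1,3) DERIV_deriv_iff_real_differentiable unfolding C2_on_def by blast
  have "((\<lambda>x. (deriv g x - deriv g a) / (x - a)) \<longlongrightarrow> D) (at a)"
    using D by (simp add: has_field_derivative_iff)
  then have "((\<lambda>x. \<bar>(deriv g x - deriv g a) / (x - a)\<bar>) \<longlongrightarrow> \<bar>D\<bar>) (at a)"
    by (rule tendsto_rabs)
  then have "\<forall>\<^sub>F x in at a. \<bar>(deriv g x - deriv g a) / (x - a)\<bar> < \<bar>D\<bar> + 1"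
    by (rule order_tendstoD) simp
  moreover have "\<forall>\<^sub>F x in at a. x \<in> I"
    using assms by (intro eventually_at_in_open') auto
  ultimately have "\<forall>\<^sub>F x in at a. \<bar>(deriv g x - deriv g a) / (x - a)\<bar> < \<bar>D\<bar> + 1 \<and> x \<in> I"
    by (rule eventually_conj)
  then obtain \<eta> where "\<eta> > 0"
    and \<eta>: "\<And>x. x \<noteq> a \<Longrightarrow> dist x a < \<eta> \<Longrightarrow> \<bar>(deriv g x - deriv g a) / (x - a)\<bar> < \<bar>D\<bar> + 1 \<and> x \<in> I"
    unfolding eventually_at by blast
  have near: "\<bar>deriv g x - deriv g a\<bar> \<le> (\<bar>D\<bar> + 1) * \<bar>x - a\<bar> \<and> x \<in> I" if "dist x a < \<eta>" for x
  proof (cases "x = a")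
    case False
    then show ?thesis using \<eta>[OF False that] by (simp add: abs_divide divide_less_eq)
  qed (use assms in simp)
  have "\<forall>\<^sub>F h in nhds 0. \<bar>g (a + h) - g a - deriv g a * h\<bar> \<le> (\<bar>D\<bar> + 1) * h\<^sup>2"
    using small_eventually[OF \<open>\<eta> > 0\<close>]
  proof eventually_elim
    case (elim h)
    let ?S = "closed_segment a (a + h)"
    have S: "\<bar>z - a\<bar> \<le> \<bar>h\<bar>" if "z \<in> ?S" for z
      using that by (auto simp: closed_segment_eq_real_ivl split: if_splits)
    have "norm ((g (a + h) - deriv g a * (a + h)) - (g a - deriv g a * a)) \<le> ((\<bar>D\<bar> + 1) * \<bar>h\<bar>) * norm (a + h - a)"
    proof (rule field_differentiable_bound[where S = ?S and f' = "\<lambda>z. deriv g z - deriv g a"])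
      fix z assume z: "z \<in> ?S"
      then have n: "\<bar>deriv g z - deriv g a\<bar> \<le> (\<bar>D\<bar> + 1) * \<bar>z - a\<bar>" "z \<in> I"
        using S[OF z] elim near[of z] by (auto simp: dist_real_def)
      show "((\<lambda>z. g z - deriv g a * z) has_field_derivative deriv g z - deriv g a) (at z within ?S)"
        by (rule has_field_derivative_at_within) (auto intro!: derivative_eq_intros dg n)
      have "(\<bar>D\<bar> + 1) * \<bar>z - a\<bar> \<le> (\<bar>D\<bar> + 1) * \<bar>h\<bar>"
        using S[OF z] by (intro mult_left_mono) auto
      with n show "norm (deriv g z - deriv g a) \<le> (\<bar>D\<bar> + 1) * \<bar>h\<bar>" by simp
    qed auto
    moreover have "((\<bar>D\<bar> + 1) * \<bar>h\<bar>) * norm (a + h - a) = (\<bar>D\<bar> + 1) * h\<^sup>2"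
      by (simp add: power2_eq_square)
    moreover have "(g (a + h) - deriv g a * (a + h)) - (g a - deriv g a * a) = g (a + h) - g a - deriv g a * h"
      by (simp add: algebra_simps)
    ultimately show ?case by (metis real_norm_def)
  qed
  then show ?thesis unfolding second_order_def by (intro exI[of _ "\<bar>D\<bar> + 1"]) auto
qed

section \<open>Affine pieces and corners of the family\<close>

lemma finite_upper_bound:
  fixes X :: "nat \<Rightarrow> real"
  obtains K where "K \<ge> 0" "\<And>k. k \<le> n \<Longrightarrow> X k \<le> K"
proof -
  have "X k \<le> (\<Sum>k\<le>n. \<bar>X k\<bar>)" if "k \<le> n" for k
    using member_le_sum[of k "{..n}" "\<lambda>k. \<bar>X k\<bar>"] that by fastforce
  then show ?thesis using that[of "\<Sum>k\<le>n. \<bar>X k\<bar>"] by (simp add: sum_nonneg)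
qed

lemma finite_lower_bound:
  fixes X :: "nat \<Rightarrow> real"
  assumes "\<And>k. k \<le> n \<Longrightarrow> X k > 0"
  obtains m where "m > 0" "\<And>k. k \<le> n \<Longrightarrow> m \<le> X k"
proof
  show "Min (X ` {..n}) > 0" using assms by (subst Min_gr_iff) auto
  show "Min (X ` {..n}) \<le> X k" if "k \<le> n" for k using that by auto
qed

text \<open>Maximum and minimum are monotone and commute with adding a constant to both arguments, so they inherit
bounds on a common displacement. The factor \<open>sgn h\<close> treats both directions of motion at once.\<close>

lemma displacement_max_min:
  fixes h :: real
  assumes "c * \<bar>h\<bar> \<le> sgn h * (u' - u) \<and> sgn h * (u' - u) \<le> C * \<bar>h\<bar>"
    and "c * \<bar>h\<bar> \<le> sgn h * (w' - w) \<and> sgn h * (w' - w) \<le> C * \<bar>h\<bar>"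
  shows "c * \<bar>h\<bar> \<le> sgn h * (max u' w' - max u w) \<and> sgn h * (max u' w' - max u w) \<le> C * \<bar>h\<bar>"
    and "c * \<bar>h\<bar> \<le> sgn h * (min u' w' - min u w) \<and> sgn h * (min u' w' - min u w) \<le> C * \<bar>h\<bar>"
proof -
  consider "h = 0" | "h > 0" | "h < 0" by linarith
  then have "(c * \<bar>h\<bar> \<le> sgn h * (max u' w' - max u w) \<and> sgn h * (max u' w' - max u w) \<le> C * \<bar>h\<bar>)
    \<and> (c * \<bar>h\<bar> \<le> sgn h * (min u' w' - min u w) \<and> sgn h * (min u' w' - min u w) \<le> C * \<bar>h\<bar>)"
    by cases (use assms in \<open>auto simp: max_def min_def\<close>)
  then show "c * \<bar>h\<bar> \<le> sgn h * (max u' w' - max u w) \<and> sgn h * (max u' w' - max u w) \<le> C * \<bar>h\<bar>"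
    and "c * \<bar>h\<bar> \<le> sgn h * (min u' w' - min u w) \<and> sgn h * (min u' w' - min u w) \<le> C * \<bar>h\<bar>"
    by blast+
qed

locale transversal_family =
  fixes I :: "real set" and n :: nat and b \<phi> :: "nat \<Rightarrow> real \<Rightarrow> real"
    and F :: "real \<Rightarrow> real \<Rightarrow> real" and f :: "real \<Rightarrow> circle \<Rightarrow> circle" and a :: real
  assumes open_I: "open I" and a_I: "a \<in> I" and n_pos: "n \<ge> 1"
    and family: "pwl_family I n b \<phi> F f"
    and C2_b: "\<And>k. k \<in> {1..n} \<Longrightarrow> C2_on I (b k)"
    and C2_\<phi>: "\<And>k. k \<in> {1..n} \<Longrightarrow> C2_on I (\<phi> k)"
    and transversal: "\<And>k. k \<in> {1..n} \<Longrightarrow>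
           deriv (\<phi> k) a
             - Max {0, slope n b \<phi> (k - 1) a * deriv (b k) a,
                       slope n b \<phi> k a * deriv (b k) a} > 0"
begin

text \<open>The corner of index \<open>0\<close> is the translate of the last one. With it, every corner of index \<open>1\<close> to \<open>n\<close> has an
affine piece with index one less on its left, with no exception at the ends of the fundamental domain.\<close>

definition corner :: "nat \<Rightarrow> real \<Rightarrow> real" where
  "corner k \<mu> = (if k = 0 then b n \<mu> - 1 else b k \<mu>)"

definition corner_value :: "nat \<Rightarrow> real \<Rightarrow> real" where
  "corner_value k \<mu> = (if k = 0 then \<phi> n \<mu> - 1 else \<phi> k \<mu>)"

abbreviation sl :: "nat \<Rightarrow> real \<Rightarrow> real" where
  "sl \<equiv> slope n b \<phi>"

definition offset :: "nat \<Rightarrow> real \<Rightarrow> real" where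
  "offset k \<mu> = corner_value k \<mu> - sl k \<mu> * corner k \<mu>"

definition piece :: "nat \<Rightarrow> real \<Rightarrow> real \<Rightarrow> real" where
  "piece k \<mu> x = offset k \<mu> + sl k \<mu> * x"

text \<open>The derivative at \<open>a\<close>, in the parameter, of the \<open>k\<close>-th affine piece at the fixed point \<open>x\<close>.\<close>

definition rate :: "nat \<Rightarrow> real \<Rightarrow> real" where
  "rate k x = deriv (offset k) a + deriv (sl k) a * x"

lemma family_facts:
  assumes "\<mu> \<in> I"
  shows "\<And>k. 1 \<le> k \<Longrightarrow> k \<le> n \<Longrightarrow> b k \<mu> < b (Suc k) \<mu>"
    and "b (Suc n) \<mu> = b 1 \<mu> + 1"
    and "\<phi> (Suc n) \<mu> = \<phi> 1 \<mu> + 1"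
    and "\<And>k. 1 \<le> k \<Longrightarrow> k \<le> n \<Longrightarrow> sl k \<mu> > 0"
    and "\<And>k. 1 \<le> k \<Longrightarrow> k \<le> n \<Longrightarrow> sl k \<mu> \<noteq> sl (k - 1) \<mu>"
    and "\<And>k x. 1 \<le> k \<Longrightarrow> k \<le> n \<Longrightarrow> b k \<mu> \<le> x \<Longrightarrow> x < b (Suc k) \<mu> \<Longrightarrow>
           F \<mu> x = \<phi> k \<mu> + sl k \<mu> * (x - b k \<mu>)"
    and "is_lift (F \<mu>) (f \<mu>)"
  using family assms unfolding pwl_family_def by auto

lemma degree_one_F: "\<mu> \<in> I \<Longrightarrow> degree_one (F \<mu>)"
  using family_facts(7) is_lift_degree_one by blast

lemma F_shift: "\<mu> \<in> I \<Longrightarrow> F \<mu> (x + of_int m) = F \<mu> x + of_int m"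
  using degree_one_int degree_one_F by blast

lemma sl_0: "sl 0 = sl n"
  by (auto simp: slope_def fun_eq_iff)

lemma corner_less: "\<mu> \<in> I \<Longrightarrow> k \<le> n \<Longrightarrow> corner k \<mu> < corner (Suc k) \<mu>"
  using family_facts(1)[of \<mu> n] family_facts(1)[of \<mu> k] family_facts(2)[of \<mu>] n_pos
  by (auto simp: corner_def)

lemma corner_mono:
  assumes "\<mu> \<in> I" "j \<le> k" "k \<le> Suc n"
  shows "corner j \<mu> \<le> corner k \<mu>"
  using assms(2,3)
proof (induction k rule: dec_induct)
  case (step m)
  then show ?case using corner_less[OF assms(1), of m] by simp
qed simp

lemma corner_last: "\<mu> \<in> I \<Longrightarrow> corner (Suc n) \<mu> = corner 1 \<mu> + 1"
  using family_facts(2) n_pos by (simp add: corner_def)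

lemma corner_first: "corner 0 \<mu> = corner n \<mu> - 1"
  using n_pos by (simp add: corner_def)

lemma sl_pos: "\<mu> \<in> I \<Longrightarrow> k \<le> n \<Longrightarrow> sl k \<mu> > 0"
  using family_facts(4)[of \<mu> k] family_facts(4)[of \<mu> n] n_pos by (cases "k = 0") (auto simp: sl_0)

lemma sl_eq:
  assumes "\<mu> \<in> I" "k \<le> n"
  shows "sl k \<mu> = (corner_value (Suc k) \<mu> - corner_value k \<mu>) / (corner (Suc k) \<mu> - corner k \<mu>)"
  using assms family_facts(2,3)[OF assms(1)] n_pos
  by (auto simp: slope_def corner_value_def corner_def Let_def algebra_simps)

lemma piece_left: "piece k \<mu> (corner k \<mu>) = corner_value k \<mu>"
  by (simp add: piece_def offset_def)

lemma piece_right: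
  assumes "\<mu> \<in> I" "k \<le> n"
  shows "piece k \<mu> (corner (Suc k) \<mu>) = corner_value (Suc k) \<mu>"
proof -
  have "sl k \<mu> * (corner (Suc k) \<mu> - corner k \<mu>) = corner_value (Suc k) \<mu> - corner_value k \<mu>"
    using corner_less[OF assms] by (simp add: sl_eq[OF assms])
  then show ?thesis by (simp add: piece_def offset_def algebra_simps)
qed

lemma F_eq_piece:
  assumes \<mu>: "\<mu> \<in> I" and k: "k \<le> n" and x: "corner k \<mu> \<le> x" "x \<le> corner (Suc k) \<mu>"
  shows "F \<mu> x = piece k \<mu> x"
proof -
  have open_cell: "F \<mu> y = piece j \<mu> y" if "1 \<le> j" "j \<le> n" "corner j \<mu> \<le> y" "y < corner (Suc j) \<mu>" for j y
    using family_facts(6)[OF \<mu> that(1,2), of y] that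
    by (simp add: corner_def corner_value_def piece_def offset_def algebra_simps)
  have at_break: "F \<mu> (corner j \<mu>) = corner_value j \<mu>" if "1 \<le> j" "j \<le> Suc n" for j
  proof (cases "j = Suc n")
    case True
    have "F \<mu> (corner 1 \<mu> + of_int 1) = corner_value 1 \<mu> + of_int 1"
      unfolding F_shift[OF \<mu>] using open_cell[of 1 "corner 1 \<mu>"] n_pos corner_less[OF \<mu>, of 1] by (simp add: piece_left)
    then show ?thesis using True family_facts(3)[OF \<mu>] by (simp add: corner_last[OF \<mu>] corner_value_def)
  next
    case False
    then show ?thesis using open_cell[of j "corner j \<mu>"] that corner_less[OF \<mu>, of j] by (simp add: piece_left)
  qed
  show ?thesis
  proof (cases "x = corner (Suc k) \<mu>")
    case True
    then show ?thesis using at_break[of "Suc k"] k by (simp add: piece_right[OF \<mu> k])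
  next
    case False
    then have lt: "x < corner (Suc k) \<mu>" using x by simp
    show ?thesis
    proof (cases "k = 0")
      case True
      have "corner n \<mu> \<le> x + of_int 1" "x + of_int 1 < corner (Suc n) \<mu>"
        using x lt True by (simp_all add: corner_first corner_last[OF \<mu>])
      then have "F \<mu> (x + of_int 1) = piece n \<mu> (x + of_int 1)" using open_cell[of n] n_pos by blast
      then have "F \<mu> x = piece n \<mu> (x + 1) - 1" unfolding F_shift[OF \<mu>] by simp
      also have "\<dots> = piece 0 \<mu> x"
        using n_pos by (simp add: piece_def offset_def corner_value_def corner_def sl_0 algebra_simps)
      finally show ?thesis using True by simp
    next
      case False
      then show ?thesis using open_cell[of k x] k x lt by simp
    qed
  qed
qed

text \<open>Near a corner the map is convex or concave. This description does not mention the position of the corner, so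
bounds for the two pieces transfer to the map even at points that lie on different sides of the corner for different
parameters.\<close>

lemma F_at_corner:
  assumes \<mu>: "\<mu> \<in> I" and k: "k < n" and x: "corner k \<mu> \<le> x" "x \<le> corner (Suc (Suc k)) \<mu>"
  shows "F \<mu> x = (if sl k \<mu> \<le> sl (Suc k) \<mu> then max (piece k \<mu> x) (piece (Suc k) \<mu> x)
                   else min (piece k \<mu> x) (piece (Suc k) \<mu> x))"
proof -
  have "piece (Suc k) \<mu> (corner (Suc k) \<mu>) = piece k \<mu> (corner (Suc k) \<mu>)"
    using piece_left[of "Suc k"] piece_right[OF \<mu>, of k] k by simp
  then have diff: "piece (Suc k) \<mu> x - piece k \<mu> x = (sl (Suc k) \<mu> - sl k \<mu>) * (x - corner (Suc k) \<mu>)"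
    by (simp add: piece_def algebra_simps)
  show ?thesis
  proof (cases "x \<le> corner (Suc k) \<mu>")
    case True
    then have "F \<mu> x = piece k \<mu> x" using F_eq_piece[OF \<mu>, of k x] k x by simp
    moreover have "sl k \<mu> \<le> sl (Suc k) \<mu> \<Longrightarrow> piece (Suc k) \<mu> x \<le> piece k \<mu> x"
      using diff mult_nonneg_nonpos[of "sl (Suc k) \<mu> - sl k \<mu>" "x - corner (Suc k) \<mu>"] True by simp
    moreover have "\<not> sl k \<mu> \<le> sl (Suc k) \<mu> \<Longrightarrow> piece k \<mu> x \<le> piece (Suc k) \<mu> x"
      using diff mult_nonpos_nonpos[of "sl (Suc k) \<mu> - sl k \<mu>" "x - corner (Suc k) \<mu>"] True by simp
    ultimately show ?thesis by auto
  next
    case False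
    then have right: "corner (Suc k) \<mu> \<le> x" by simp
    then have "F \<mu> x = piece (Suc k) \<mu> x" using F_eq_piece[OF \<mu>, of "Suc k" x] k x by simp
    moreover have "sl k \<mu> \<le> sl (Suc k) \<mu> \<Longrightarrow> piece k \<mu> x \<le> piece (Suc k) \<mu> x"
      using diff right by (metis diff_ge_0_iff_ge mult_nonneg_nonneg)
    moreover have "\<not> sl k \<mu> \<le> sl (Suc k) \<mu> \<Longrightarrow> piece (Suc k) \<mu> x \<le> piece k \<mu> x"
      using diff mult_nonpos_nonneg[of "sl (Suc k) \<mu> - sl k \<mu>" "x - corner (Suc k) \<mu>"] right by simp
    ultimately show ?thesis by auto
  qed
qed

lemma eventually_I: "\<forall>\<^sub>F \<mu> in nhds a. \<mu> \<in> I"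
  using open_I a_I by (rule eventually_nhds_in_open)

lemma second_order_corner:
  assumes "k \<le> Suc n"
  shows "second_order (corner k) a (deriv (corner k) a)"
proof -
  have b: "second_order (b j) a (deriv (b j) a)" if "1 \<le> j" "j \<le> n" for j
    using second_order_C2[OF C2_b open_I a_I, of j] that by simp
  consider "k = 0" | "1 \<le> k" "k \<le> n" | "k = Suc n" using assms by linarith
  then have "\<exists>d. second_order (corner k) a d"
  proof cases
    case 1
    have "second_order (\<lambda>\<mu>. b n \<mu> - 1) a (deriv (b n) a - 0)"
      by (intro second_order_diff second_order_const b n_pos order_refl)
    then show ?thesis using 1 by (auto simp: corner_def[abs_def])
  next
    case 2
    then show ?thesis using b by (auto simp: corner_def[abs_def])
  next
    case 3
    have "second_order (\<lambda>\<mu>. b 1 \<mu> + 1) a (deriv (b 1) a + 0)"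
      by (intro second_order_add second_order_const b n_pos order_refl)
    moreover have "\<forall>\<^sub>F \<mu> in nhds a. b 1 \<mu> + 1 = corner k \<mu>"
      using eventually_I by eventually_elim (use 3 family_facts(2) in \<open>simp add: corner_def\<close>)
    ultimately show ?thesis using second_order_cong by blast
  qed
  then show ?thesis using second_order_deriv by blast
qed

lemma second_order_corner_value:
  assumes "k \<le> Suc n"
  shows "second_order (corner_value k) a (deriv (corner_value k) a)"
proof -
  have \<phi>: "second_order (\<phi> j) a (deriv (\<phi> j) a)" if "1 \<le> j" "j \<le> n" for j
    using second_order_C2[OF C2_\<phi> open_I a_I, of j] that by simp
  consider "k = 0" | "1 \<le> k" "k \<le> n" | "k = Suc n" using assms by linarith
  then have "\<exists>d. second_order (corner_value k) a d"
  proof cases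
    case 1
    have "second_order (\<lambda>\<mu>. \<phi> n \<mu> - 1) a (deriv (\<phi> n) a - 0)"
      by (intro second_order_diff second_order_const \<phi> n_pos order_refl)
    then show ?thesis using 1 by (auto simp: corner_value_def[abs_def])
  next
    case 2
    then show ?thesis using \<phi> by (auto simp: corner_value_def[abs_def])
  next
    case 3
    have "second_order (\<lambda>\<mu>. \<phi> 1 \<mu> + 1) a (deriv (\<phi> 1) a + 0)"
      by (intro second_order_add second_order_const \<phi> n_pos order_refl)
    moreover have "\<forall>\<^sub>F \<mu> in nhds a. \<phi> 1 \<mu> + 1 = corner_value k \<mu>"
      using eventually_I by eventually_elim (use 3 family_facts(3) in \<open>simp add: corner_value_def\<close>)
    ultimately show ?thesis using second_order_cong by blast
  qed
  then show ?thesis using second_order_deriv by blast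
qed

lemma second_order_sl:
  assumes "k \<le> n"
  shows "second_order (sl k) a (deriv (sl k) a)"
proof -
  let ?w = "\<lambda>\<mu>. corner (Suc k) \<mu> - corner k \<mu>"
  have "?w a \<noteq> 0" using corner_less[OF a_I assms] by simp
  moreover have "second_order ?w a (deriv (corner (Suc k)) a - deriv (corner k) a)"
    using assms by (intro second_order_diff second_order_corner) auto
  ultimately have "\<exists>d. second_order (\<lambda>\<mu>. 1 / ?w \<mu>) a d"
    using second_order_inverse by blast
  moreover have "second_order (\<lambda>\<mu>. corner_value (Suc k) \<mu> - corner_value k \<mu>) a
      (deriv (corner_value (Suc k)) a - deriv (corner_value k) a)"
    using assms by (intro second_order_diff second_order_corner_value) auto
  ultimately have "\<exists>d. second_order (\<lambda>\<mu>. (corner_value (Suc k) \<mu> - corner_value k \<mu>) * (1 / ?w \<mu>)) a d"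
    using second_order_mult by blast
  moreover have "\<forall>\<^sub>F \<mu> in nhds a. (corner_value (Suc k) \<mu> - corner_value k \<mu>) * (1 / ?w \<mu>) = sl k \<mu>"
    using eventually_I by eventually_elim (simp add: sl_eq assms)
  ultimately have "\<exists>d. second_order (sl k) a d" using second_order_cong by blast
  then show ?thesis using second_order_deriv by blast
qed

lemma second_order_offset:
  assumes "k \<le> n"
  shows "second_order (offset k) a
    (deriv (corner_value k) a - (deriv (sl k) a * corner k a + sl k a * deriv (corner k) a))"
  using assms unfolding offset_def[abs_def]
  by (intro second_order_diff second_order_mult second_order_corner_value second_order_corner second_order_sl) auto

lemma rate_left:
  assumes "k \<le> n"
  shows "rate k (corner k a) = deriv (corner_value k) a - sl k a * deriv (corner k) a"
  by (simp add: rate_def second_order_deriv[OF second_order_offset[OF assms]])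

text \<open>Differentiate the identity \<open>piece k \<mu> (corner (Suc k) \<mu>) = corner_value (Suc k) \<mu>\<close>; the left endpoint is
handled by the definition of the offset.\<close>

lemma rate_right:
  assumes "k \<le> n"
  shows "rate k (corner (Suc k) a) = deriv (corner_value (Suc k)) a - sl k a * deriv (corner (Suc k)) a"
proof -
  have "second_order (\<lambda>\<mu>. piece k \<mu> (corner (Suc k) \<mu>)) a
      (deriv (offset k) a + (deriv (sl k) a * corner (Suc k) a + sl k a * deriv (corner (Suc k)) a))"
    unfolding piece_def using assms second_order_offset[OF assms] second_order_deriv[OF second_order_offset[OF assms]]
    by (intro second_order_add second_order_mult second_order_corner second_order_sl) auto
  moreover have "\<forall>\<^sub>F \<mu> in nhds a. piece k \<mu> (corner (Suc k) \<mu>) = corner_value (Suc k) \<mu>"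
    using eventually_I by eventually_elim (simp add: piece_right assms)
  ultimately have "second_order (corner_value (Suc k)) a
      (deriv (offset k) a + (deriv (sl k) a * corner (Suc k) a + sl k a * deriv (corner (Suc k)) a))"
    by (rule second_order_cong)
  from second_order_deriv[OF this] show ?thesis by (simp add: rate_def)
qed

lemma deriv_ends:
  "deriv (corner 0) a = deriv (corner n) a" "deriv (corner_value 0) a = deriv (corner_value n) a"
  "deriv (corner (Suc n)) a = deriv (corner 1) a" "deriv (corner_value (Suc n)) a = deriv (corner_value 1) a"
proof -
  have "second_order (\<lambda>\<mu>. corner n \<mu> - 1) a (deriv (corner n) a - 0)"
    "second_order (\<lambda>\<mu>. corner_value n \<mu> - 1) a (deriv (corner_value n) a - 0)"
    by (intro second_order_diff second_order_const second_order_corner second_order_corner_value; simp)+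
  moreover have "corner 0 = (\<lambda>\<mu>. corner n \<mu> - 1)" "corner_value 0 = (\<lambda>\<mu>. corner_value n \<mu> - 1)"
    using n_pos by (auto simp: corner_def corner_value_def)
  ultimately show "deriv (corner 0) a = deriv (corner n) a" "deriv (corner_value 0) a = deriv (corner_value n) a"
    using second_order_deriv by fastforce+
  have "second_order (\<lambda>\<mu>. corner 1 \<mu> + 1) a (deriv (corner 1) a + 0)"
    "second_order (\<lambda>\<mu>. corner_value 1 \<mu> + 1) a (deriv (corner_value 1) a + 0)"
    using n_pos by (intro second_order_add second_order_const second_order_corner second_order_corner_value; simp)+
  moreover have "\<forall>\<^sub>F \<mu> in nhds a. corner 1 \<mu> + 1 = corner (Suc n) \<mu>"
    using eventually_I by eventually_elim (simp add: corner_last)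
  moreover have "\<forall>\<^sub>F \<mu> in nhds a. corner_value 1 \<mu> + 1 = corner_value (Suc n) \<mu>"
    using eventually_I by eventually_elim (use family_facts(3) n_pos in \<open>simp add: corner_value_def\<close>)
  ultimately have "second_order (corner (Suc n)) a (deriv (corner 1) a + 0)"
    "second_order (corner_value (Suc n)) a (deriv (corner_value 1) a + 0)"
    using second_order_cong by blast+
  then show "deriv (corner (Suc n)) a = deriv (corner 1) a" "deriv (corner_value (Suc n)) a = deriv (corner_value 1) a"
    using second_order_deriv by fastforce+
qed

lemma transversal_sides:
  assumes "1 \<le> k" "k \<le> n"
  shows "deriv (corner_value k) a - sl (k - 1) a * deriv (corner k) a > 0"
    and "deriv (corner_value k) a - sl k a * deriv (corner k) a > 0"
proof -
  have "corner k = b k" "corner_value k = \<phi> k" using assms by (auto simp: corner_def corner_value_def)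
  then show "deriv (corner_value k) a - sl (k - 1) a * deriv (corner k) a > 0"
    and "deriv (corner_value k) a - sl k a * deriv (corner k) a > 0"
    using transversal[of k] assms by (auto simp: max_def split: if_splits)
qed

text \<open>The transversality condition at a corner involves both adjacent slopes, so it bounds the rates of both
adjacent pieces there.\<close>

lemma rate_ends_pos:
  assumes "k \<le> n"
  shows "rate k (corner k a) > 0" "rate k (corner (Suc k) a) > 0"
proof -
  show "rate k (corner k a) > 0"
  proof (cases "k = 0")
    case True
    have "rate k (corner k a) = deriv (corner_value n) a - sl n a * deriv (corner n) a"
      using rate_left[of 0] by (simp add: True deriv_ends sl_0)
    then show ?thesis using transversal_sides(2)[of n] n_pos by simp
  next
    case False
    then show ?thesis using rate_left[OF assms] transversal_sides(2)[of k] assms by simp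
  qed
  show "rate k (corner (Suc k) a) > 0"
  proof (cases "k = n")
    case True
    have "rate k (corner (Suc k) a) = deriv (corner_value 1) a - sl 0 a * deriv (corner 1) a"
      using rate_right[of n] by (simp only: True deriv_ends sl_0 order_refl)
    then show ?thesis using transversal_sides(1)[of 1] n_pos by simp
  next
    case False
    then show ?thesis using rate_right[OF assms] transversal_sides(1)[of "Suc k"] assms by simp
  qed
qed

end

section \<open>Displacement under a change of the parameter\<close>

lemma eventually_finite_bound:
  fixes X :: "nat \<Rightarrow> real \<Rightarrow> real"
  assumes X: "\<And>k. k \<le> n \<Longrightarrow> \<exists>K\<ge>0. \<forall>\<^sub>F h in nhds 0. X k h \<le> K * Y h" and Y: "\<And>h. Y h \<ge> 0"
  shows "\<exists>K\<ge>0. \<forall>\<^sub>F h in nhds 0. \<forall>k\<le>n. X k h \<le> K * Y h"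
proof -
  obtain \<kappa> where \<kappa>: "\<And>k. k \<le> n \<Longrightarrow> \<forall>\<^sub>F h in nhds 0. X k h \<le> \<kappa> k * Y h"
    using X by metis
  obtain K where "K \<ge> 0" and K: "\<And>k. k \<le> n \<Longrightarrow> \<kappa> k \<le> K"
    using finite_upper_bound by metis
  have "\<forall>\<^sub>F h in nhds 0. \<forall>k\<in>{..n}. X k h \<le> \<kappa> k * Y h"
    using \<kappa> by (intro eventually_ball_finite) auto
  then have "\<forall>\<^sub>F h in nhds 0. \<forall>k\<le>n. X k h \<le> K * Y h"
  proof eventually_elim
    case (elim h)
    show ?case
    proof (intro allI impI)
      fix k assume "k \<le> n"
      then have "X k h \<le> \<kappa> k * Y h" using elim by blast
      also have "\<dots> \<le> K * Y h" using K[OF \<open>k \<le> n\<close>] Y by (rule mult_right_mono)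
      finally show "X k h \<le> K * Y h" .
    qed
  qed
  then show ?thesis using \<open>K \<ge> 0\<close> by blast
qed

lemma affine_bounds:
  fixes \<alpha> \<beta> x l r \<delta> :: real
  assumes "l - \<delta> \<le> x" "x \<le> r + \<delta>" "0 \<le> \<delta>" "l \<le> r"
  shows "min (\<alpha> + \<beta> * l) (\<alpha> + \<beta> * r) - \<bar>\<beta>\<bar> * \<delta> \<le> \<alpha> + \<beta> * x"
    and "\<alpha> + \<beta> * x \<le> max (\<alpha> + \<beta> * l) (\<alpha> + \<beta> * r) + \<bar>\<beta>\<bar> * \<delta>"
proof -
  show "min (\<alpha> + \<beta> * l) (\<alpha> + \<beta> * r) - \<bar>\<beta>\<bar> * \<delta> \<le> \<alpha> + \<beta> * x"
  proof (cases "\<beta> \<ge> 0")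
    case True
    then have "\<beta> * (l - \<delta>) \<le> \<beta> * x" using assms by (intro mult_left_mono) auto
    then show ?thesis using True by (simp add: right_diff_distrib)
  next
    case False
    then have "\<beta> * (r + \<delta>) \<le> \<beta> * x" using assms by (intro mult_left_mono_neg) auto
    then show ?thesis using False by (simp add: distrib_left)
  qed
  show "\<alpha> + \<beta> * x \<le> max (\<alpha> + \<beta> * l) (\<alpha> + \<beta> * r) + \<bar>\<beta>\<bar> * \<delta>"
  proof (cases "\<beta> \<ge> 0")
    case True
    then have "\<beta> * x \<le> \<beta> * (r + \<delta>)" using assms by (intro mult_left_mono) auto
    then show ?thesis using True by (simp add: distrib_left)
  next
    case False
    then have "\<beta> * x \<le> \<beta> * (l - \<delta>)" using assms by (intro mult_left_mono_neg) auto
    then show ?thesis using False by (simp add: right_diff_distrib)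
  qed
qed

context transversal_family
begin

text \<open>A rate is affine in \<open>x\<close>, so its positivity at the two ends of a piece gives uniform bounds on the piece, and
on a neighbourhood of it whose radius is the same for all pieces.\<close>

lemma rate_margin:
  obtains c C \<delta> where "c > 0" "C > 0" "\<delta> > 0"
    "\<And>k. k \<le> n \<Longrightarrow> 4 * \<delta> \<le> corner (Suc k) a - corner k a"
    "\<And>k x. k \<le> n \<Longrightarrow> corner k a - \<delta> \<le> x \<Longrightarrow> x \<le> corner (Suc k) a + \<delta> \<Longrightarrow> c \<le> rate k x \<and> rate k x \<le> C"
proof -
  obtain m where m: "m > 0" "\<And>k. k \<le> n \<Longrightarrow> m \<le> min (rate k (corner k a)) (rate k (corner (Suc k) a))"
    using finite_lower_bound[of n "\<lambda>k. min (rate k (corner k a)) (rate k (corner (Suc k) a))"] rate_ends_pos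
    by auto
  obtain C where C: "C \<ge> 0" "\<And>k. k \<le> n \<Longrightarrow> max (rate k (corner k a)) (rate k (corner (Suc k) a)) \<le> C"
    using finite_upper_bound[of n "\<lambda>k. max (rate k (corner k a)) (rate k (corner (Suc k) a))"] by blast
  obtain D where D: "D \<ge> 0" "\<And>k. k \<le> n \<Longrightarrow> \<bar>deriv (sl k) a\<bar> \<le> D"
    using finite_upper_bound[of n "\<lambda>k. \<bar>deriv (sl k) a\<bar>"] by blast
  obtain w where w: "w > 0" "\<And>k. k \<le> n \<Longrightarrow> w \<le> corner (Suc k) a - corner k a"
    using finite_lower_bound[of n "\<lambda>k. corner (Suc k) a - corner k a"] corner_less[OF a_I] by auto
  define \<delta> where "\<delta> = min (w / 4) (m / 2 / (D + 1))"
  have \<delta>: "\<delta> > 0" using w m D by (simp add: \<delta>_def)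
  have "D * \<delta> \<le> (D + 1) * (m / 2 / (D + 1))"
    using \<delta> D by (intro mult_mono) (auto simp: \<delta>_def)
  also have "\<dots> = m / 2" using D by (simp add: field_simps)
  finally have D\<delta>: "D * \<delta> \<le> m / 2" .
  have "m / 2 \<le> rate k x \<and> rate k x \<le> C + m"
    if k: "k \<le> n" and x: "corner k a - \<delta> \<le> x" "x \<le> corner (Suc k) a + \<delta>" for k x
  proof -
    have "corner k a \<le> corner (Suc k) a" using corner_less[OF a_I k] by simp
    from affine_bounds[OF x _ this, of "deriv (offset k) a" "deriv (sl k) a", folded rate_def]
    have "min (rate k (corner k a)) (rate k (corner (Suc k) a)) - \<bar>deriv (sl k) a\<bar> * \<delta> \<le> rate k x"
      "rate k x \<le> max (rate k (corner k a)) (rate k (corner (Suc k) a)) + \<bar>deriv (sl k) a\<bar> * \<delta>"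
      using \<delta> by auto
    moreover have "\<bar>deriv (sl k) a\<bar> * \<delta> \<le> D * \<delta>"
      using D(2)[OF k] \<delta> by (intro mult_right_mono) auto
    ultimately show ?thesis using D\<delta> m(1) m(2)[OF k] C(2)[OF k] by linarith
  qed
  moreover have "4 * \<delta> \<le> corner (Suc k) a - corner k a" if "k \<le> n" for k
    using w(2)[OF that] by (simp add: \<delta>_def)
  ultimately show ?thesis using that[of "m / 2" "C + m" \<delta>] \<delta> m(1) C(1) by simp
qed

lemma uniform_expansion:
  obtains K \<eta> where "K \<ge> 0" "\<eta> > 0"
    "\<And>h. \<bar>h\<bar> < \<eta> \<Longrightarrow> a + h \<in> I"
    "\<And>h k. \<bar>h\<bar> < \<eta> \<Longrightarrow> k \<le> Suc n \<Longrightarrow> \<bar>corner k (a + h) - corner k a\<bar> \<le> K * \<bar>h\<bar>"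
    "\<And>h k. \<bar>h\<bar> < \<eta> \<Longrightarrow> k \<le> n \<Longrightarrow> \<bar>sl k (a + h) - sl k a\<bar> \<le> K * \<bar>h\<bar>"
    "\<And>h k. \<bar>h\<bar> < \<eta> \<Longrightarrow> k < n \<Longrightarrow> sl k (a + h) \<le> sl (Suc k) (a + h) \<longleftrightarrow> sl k a \<le> sl (Suc k) a"
    "\<And>h k x. \<bar>h\<bar> < \<eta> \<Longrightarrow> k \<le> n \<Longrightarrow> \<bar>x\<bar> \<le> M \<Longrightarrow> \<bar>piece k (a + h) x - piece k a x - h * rate k x\<bar> \<le> K * h\<^sup>2"
proof -
  have "\<exists>K\<ge>0. \<forall>\<^sub>F h in nhds 0. \<bar>corner k (a + h) - corner k a\<bar> \<le> K * \<bar>h\<bar>" if "k \<le> Suc n" for k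
    using second_order_lipschitz[OF second_order_corner[OF that]] by metis
  then have "\<exists>K\<ge>0. \<forall>\<^sub>F h in nhds 0. \<forall>k\<le>Suc n. \<bar>corner k (a + h) - corner k a\<bar> \<le> K * \<bar>h\<bar>"
    by (intro eventually_finite_bound) auto
  then obtain Kc where Kc: "Kc \<ge> 0" "\<forall>\<^sub>F h in nhds 0. \<forall>k\<le>Suc n. \<bar>corner k (a + h) - corner k a\<bar> \<le> Kc * \<bar>h\<bar>"
    by blast
  have "\<exists>K\<ge>0. \<forall>\<^sub>F h in nhds 0. \<bar>sl k (a + h) - sl k a\<bar> \<le> K * \<bar>h\<bar>" if "k \<le> n" for k
    using second_order_lipschitz[OF second_order_sl[OF that]] by metis
  then have "\<exists>K\<ge>0. \<forall>\<^sub>F h in nhds 0. \<forall>k\<le>n. \<bar>sl k (a + h) - sl k a\<bar> \<le> K * \<bar>h\<bar>"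
    by (intro eventually_finite_bound) auto
  then obtain Ks where Ks: "Ks \<ge> 0" "\<forall>\<^sub>F h in nhds 0. \<forall>k\<le>n. \<bar>sl k (a + h) - sl k a\<bar> \<le> Ks * \<bar>h\<bar>"
    by blast
  have "\<exists>K\<ge>0. \<forall>\<^sub>F h in nhds 0. \<bar>sl k (a + h) - sl k a - deriv (sl k) a * h\<bar> \<le> K * h\<^sup>2" if "k \<le> n" for k
    using second_order_sl[OF that] unfolding second_order_def .
  then have "\<exists>K\<ge>0. \<forall>\<^sub>F h in nhds 0. \<forall>k\<le>n. \<bar>sl k (a + h) - sl k a - deriv (sl k) a * h\<bar> \<le> K * h\<^sup>2"
    by (intro eventually_finite_bound) auto
  then obtain Kt where Kt: "Kt \<ge> 0" "\<forall>\<^sub>F h in nhds 0. \<forall>k\<le>n. \<bar>sl k (a + h) - sl k a - deriv (sl k) a * h\<bar> \<le> Kt * h\<^sup>2"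
    by blast
  have "\<exists>K\<ge>0. \<forall>\<^sub>F h in nhds 0. \<bar>offset k (a + h) - offset k a - deriv (offset k) a * h\<bar> \<le> K * h\<^sup>2" if "k \<le> n" for k
    using second_order_offset[OF that] unfolding second_order_deriv[OF second_order_offset[OF that]] second_order_def .
  then have "\<exists>K\<ge>0. \<forall>\<^sub>F h in nhds 0. \<forall>k\<le>n. \<bar>offset k (a + h) - offset k a - deriv (offset k) a * h\<bar> \<le> K * h\<^sup>2"
    by (intro eventually_finite_bound) auto
  then obtain Ko where Ko: "Ko \<ge> 0" "\<forall>\<^sub>F h in nhds 0. \<forall>k\<le>n. \<bar>offset k (a + h) - offset k a - deriv (offset k) a * h\<bar> \<le> Ko * h\<^sup>2"
    by blast
  have "\<forall>\<^sub>F h in nhds 0. sl k (a + h) \<le> sl (Suc k) (a + h) \<longleftrightarrow> sl k a \<le> sl (Suc k) a" if "k < n" for k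
  proof -
    have "isCont (\<lambda>\<mu>. sl (Suc k) \<mu> - sl k \<mu>) a"
      using that by (intro continuous_intros second_order_isCont[OF second_order_sl]) auto
    then have lim: "((\<lambda>\<mu>. sl (Suc k) \<mu> - sl k \<mu>) \<longlongrightarrow> sl (Suc k) a - sl k a) (nhds a)"
      by (simp add: continuous_at tendsto_nhds_iff)
    have "sl (Suc k) a \<noteq> sl k a" using family_facts(5)[OF a_I, of "Suc k"] that by simp
    then consider "sl k a < sl (Suc k) a" | "sl (Suc k) a < sl k a" by linarith
    then have "\<forall>\<^sub>F \<mu> in nhds a. sl k \<mu> \<le> sl (Suc k) \<mu> \<longleftrightarrow> sl k a \<le> sl (Suc k) a"
    proof cases
      case 1
      from order_tendstoD(1)[OF lim, of 0] 1 show ?thesis by (auto elim: eventually_mono)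
    next
      case 2
      from order_tendstoD(2)[OF lim, of 0] 2 show ?thesis by (auto elim: eventually_mono)
    qed
    then show ?thesis by (simp add: eventually_nhds_shift[of "\<lambda>\<mu>. sl k \<mu> \<le> sl (Suc k) \<mu> \<longleftrightarrow> sl k a \<le> sl (Suc k) a"])
  qed
  then have ord: "\<forall>\<^sub>F h in nhds 0. \<forall>k\<in>{..<n}. sl k (a + h) \<le> sl (Suc k) (a + h) \<longleftrightarrow> sl k a \<le> sl (Suc k) a"
    by (intro eventually_ball_finite) auto
  have inI: "\<forall>\<^sub>F h in nhds 0. a + h \<in> I"
    using eventually_I by (simp add: eventually_nhds_shift[of "\<lambda>\<mu>. \<mu> \<in> I"])
  from eventually_conj[OF Kc(2) eventually_conj[OF Ks(2) eventually_conj[OF Kt(2)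
        eventually_conj[OF Ko(2) eventually_conj[OF ord inI]]]]]
  obtain \<eta> where "\<eta> > 0" and \<eta>: "\<And>h. dist h 0 < \<eta> \<Longrightarrow>
      (\<forall>k\<le>Suc n. \<bar>corner k (a + h) - corner k a\<bar> \<le> Kc * \<bar>h\<bar>) \<and>
      (\<forall>k\<le>n. \<bar>sl k (a + h) - sl k a\<bar> \<le> Ks * \<bar>h\<bar>) \<and>
      (\<forall>k\<le>n. \<bar>sl k (a + h) - sl k a - deriv (sl k) a * h\<bar> \<le> Kt * h\<^sup>2) \<and>
      (\<forall>k\<le>n. \<bar>offset k (a + h) - offset k a - deriv (offset k) a * h\<bar> \<le> Ko * h\<^sup>2) \<and>
      (\<forall>k\<in>{..<n}. sl k (a + h) \<le> sl (Suc k) (a + h) \<longleftrightarrow> sl k a \<le> sl (Suc k) a) \<and> a + h \<in> I"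
    unfolding eventually_nhds_metric by blast
  define K where "K = Kc + Ks + (Ko + Kt * \<bar>M\<bar>)"
  have K: "K \<ge> 0" "Kc \<le> K" "Ks \<le> K" "Ko + Kt * \<bar>M\<bar> \<le> K"
    using Kc(1) Ks(1) Kt(1) Ko(1) by (simp_all add: K_def)
  show ?thesis
  proof (rule that[OF K(1) \<open>\<eta> > 0\<close>])
    show "\<bar>corner k (a + h) - corner k a\<bar> \<le> K * \<bar>h\<bar>" if "\<bar>h\<bar> < \<eta>" "k \<le> Suc n" for h k
      using \<eta>[of h] that mult_right_mono[OF K(2), of "\<bar>h\<bar>"] by (fastforce simp: dist_real_def)
    show "\<bar>sl k (a + h) - sl k a\<bar> \<le> K * \<bar>h\<bar>" if "\<bar>h\<bar> < \<eta>" "k \<le> n" for h k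
      using \<eta>[of h] that mult_right_mono[OF K(3), of "\<bar>h\<bar>"] by (fastforce simp: dist_real_def)
    show "\<bar>piece k (a + h) x - piece k a x - h * rate k x\<bar> \<le> K * h\<^sup>2"
      if h: "\<bar>h\<bar> < \<eta>" and k: "k \<le> n" and x: "\<bar>x\<bar> \<le> M" for h k x
    proof -
      let ?o = "offset k (a + h) - offset k a - deriv (offset k) a * h"
      let ?s = "sl k (a + h) - sl k a - deriv (sl k) a * h"
      have o: "\<bar>?o\<bar> \<le> Ko * h\<^sup>2" and s: "\<bar>?s\<bar> \<le> Kt * h\<^sup>2"
        using \<eta>[of h] h k by (simp_all add: dist_real_def)
      have "piece k (a + h) x - piece k a x - h * rate k x = ?o + ?s * x"
        by (simp add: piece_def rate_def algebra_simps)
      moreover have "\<bar>?s * x\<bar> \<le> (Kt * h\<^sup>2) * \<bar>M\<bar>"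
        unfolding abs_mult using s x Kt(1) by (intro mult_mono) auto
      ultimately have "\<bar>piece k (a + h) x - piece k a x - h * rate k x\<bar> \<le> Ko * h\<^sup>2 + (Kt * h\<^sup>2) * \<bar>M\<bar>"
        using o by linarith
      also have "\<dots> = (Ko + Kt * \<bar>M\<bar>) * h\<^sup>2" by (simp add: algebra_simps)
      also have "\<dots> \<le> K * h\<^sup>2" using K(4) by (rule mult_right_mono) simp
      finally show ?thesis .
    qed
  qed (use \<eta> in \<open>auto simp: dist_real_def\<close>)
qed

text \<open>Each point is translated by an integer into the fundamental domain between the corners \<open>1\<close> and \<open>n + 1\<close>, where the
half-open cells between successive corners form a partition.\<close>

definition cell_shift :: "real \<Rightarrow> int" where
  "cell_shift x = \<lfloor>x - corner 1 a\<rfloor>"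

definition in_cell :: "nat \<Rightarrow> real \<Rightarrow> bool" where
  "in_cell k y \<longleftrightarrow> 1 \<le> k \<and> k \<le> n \<and> corner k a \<le> y \<and> y < corner (Suc k) a"

definition cell :: "real \<Rightarrow> nat" where
  "cell x = (SOME k. in_cell k (x - of_int (cell_shift x)))"

lemma in_cell_range:
  assumes "in_cell k y"
  shows "corner 1 a \<le> y \<and> y < corner 1 a + 1"
proof -
  have k: "1 \<le> k" "k \<le> n" "corner k a \<le> y" "y < corner (Suc k) a"
    using assms by (simp_all add: in_cell_def)
  have "corner 1 a \<le> corner k a" "corner (Suc k) a \<le> corner (Suc n) a"
    using k by (auto intro!: corner_mono a_I)
  then show ?thesis using k corner_last[OF a_I] by linarith
qed

lemma in_cell_unique:
  assumes "in_cell j y" "in_cell k y"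
  shows "j = k"
proof -
  have False if "in_cell j y" "in_cell k y" "j < k" for j k
    using that corner_mono[OF a_I, of "Suc j" k] by (auto simp: in_cell_def)
  then show ?thesis using assms by (meson linorder_neqE_nat)
qed

lemma in_cell_exists:
  assumes "corner 1 a \<le> y" "y < corner 1 a + 1"
  shows "\<exists>k. in_cell k y"
proof -
  let ?J = "{k \<in> {1..n}. corner k a \<le> y}"
  have J: "1 \<in> ?J" "finite ?J" using assms n_pos by auto
  define k where "k = Max ?J"
  have k: "k \<in> ?J" unfolding k_def using J by (intro Max_in) auto
  have "y < corner (Suc k) a"
  proof (cases "k = n")
    case True
    then show ?thesis using assms corner_last[OF a_I] by simp
  next
    case False
    then have "Suc k \<in> {1..n}" using k by simp
    moreover have "Suc k \<notin> ?J" using Max_ge[OF J(2), of "Suc k"] unfolding k_def[symmetric] by auto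
    ultimately show ?thesis by auto
  qed
  with k show ?thesis by (auto simp: in_cell_def)
qed

lemma in_cell_cell: "in_cell (cell x) (x - of_int (cell_shift x))"
proof -
  have "corner 1 a \<le> x - of_int (cell_shift x)" "x - of_int (cell_shift x) < corner 1 a + 1"
    unfolding cell_shift_def by linarith+
  from someI_ex[OF in_cell_exists[OF this]] show ?thesis by (simp add: cell_def)
qed

lemma cell_eqI:
  assumes "in_cell k (x - of_int m)"
  shows "cell_shift x = m" "cell x = k"
proof -
  show m: "cell_shift x = m"
    unfolding cell_shift_def using in_cell_range[OF assms] by (intro floor_unique) auto
  show "cell x = k" using in_cell_unique[OF in_cell_cell] assms m by metis
qed

lemma cell_periodic: "cell_shift (x + 1) = cell_shift x + 1" "cell (x + 1) = cell x"
proof -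
  have "in_cell (cell x) ((x + 1) - of_int (cell_shift x + 1))" using in_cell_cell by simp
  from cell_eqI[OF this] show "cell_shift (x + 1) = cell_shift x + 1" "cell (x + 1) = cell x" by blast+
qed

definition corners :: "real set" where
  "corners = int_translates ((\<lambda>k. corner k a) ` {1..n})"

lemma corner_in_corners:
  assumes "k \<le> Suc n"
  shows "corner k a + of_int m \<in> corners"
proof -
  consider "k = 0" | "1 \<le> k" "k \<le> n" | "k = Suc n" using assms by linarith
  then have "\<exists>j\<in>{1..n}. \<exists>z::int. corner k a + of_int m = corner j a + of_int z"
  proof cases
    case 1
    then show ?thesis using n_pos by (intro bexI[of _ n] exI[of _ "m - 1"]) (auto simp: corner_first)
  next
    case 2
    then show ?thesis by (intro bexI[of _ k] exI[of _ m]) auto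
  next
    case 3
    then show ?thesis using n_pos corner_last[OF a_I]
      by (intro bexI[of _ 1] exI[of _ "m + 1"]) auto
  qed
  then show ?thesis unfolding corners_def int_translates_iff by (simp add: image_iff)
qed

lemma cell_const:
  assumes avoid: "closed_segment x y \<inter> corners = {}"
  shows "cell_shift x = cell_shift y" "cell x = cell y"
proof -
  have "cell_shift y = cell_shift x \<and> cell y = cell x" if "x \<le> y" "closed_segment x y \<inter> corners = {}" for x y
  proof -
    let ?m = "cell_shift x" and ?k = "cell x"
    note k = in_cell_cell[of x, unfolded in_cell_def]
    have "corner (Suc ?k) a + of_int ?m \<in> corners" using k by (intro corner_in_corners) auto
    then have "corner (Suc ?k) a + of_int ?m \<notin> {x..y}"
      using that by (auto simp: closed_segment_eq_real_ivl)
    then have "y < corner (Suc ?k) a + of_int ?m" using k by auto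
    then have "in_cell ?k (y - of_int ?m)" using k that by (auto simp: in_cell_def)
    from cell_eqI[OF this] show ?thesis by blast
  qed
  moreover have "closed_segment y x \<inter> corners = {}" using avoid by (metis closed_segment_commute)
  ultimately have "cell_shift x = cell_shift y \<and> cell x = cell y"
    using avoid by (metis linear)
  then show "cell_shift x = cell_shift y" "cell x = cell y" by blast+
qed

definition slope_at :: "real \<Rightarrow> real" where
  "slope_at x = sl (cell x) a"

definition rate_at :: "real \<Rightarrow> real" where
  "rate_at x = rate (cell x) (x - of_int (cell_shift x))"

text \<open>In the middle of a cell, both maps are given by the same affine piece. Within \<open>\<delta>\<close> of a corner, both are
the maximum, or both the minimum, of the same two pieces, since distinct slopes at the critical parameter keep
their order nearby.\<close>

lemma perturbation_bounds:
  obtains c C \<eta> where "c > 0" "C > 0" "\<eta> > 0"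
    "\<And>h. \<bar>h\<bar> < \<eta> \<Longrightarrow> a + h \<in> I"
    "\<And>x. c \<le> rate_at x \<and> rate_at x \<le> C"
    "\<And>h x. \<bar>h\<bar> < \<eta> \<Longrightarrow> c * \<bar>h\<bar> \<le> sgn h * (F (a + h) x - F a x) \<and> sgn h * (F (a + h) x - F a x) \<le> C * \<bar>h\<bar>"
proof -
  obtain c C \<delta> where c: "c > 0" "C > 0" "\<delta> > 0"
    and gap: "\<And>k. k \<le> n \<Longrightarrow> 4 * \<delta> \<le> corner (Suc k) a - corner k a"
    and rate: "\<And>k x. k \<le> n \<Longrightarrow> corner k a - \<delta> \<le> x \<Longrightarrow> x \<le> corner (Suc k) a + \<delta> \<Longrightarrow> c \<le> rate k x \<and> rate k x \<le> C"
    using rate_margin by blast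
  define M where "M = \<bar>corner 0 a\<bar> + \<bar>corner (Suc n) a\<bar> + \<delta>"
  obtain K \<eta> where K: "K \<ge> 0" "\<eta> > 0"
    and inI: "\<And>h. \<bar>h\<bar> < \<eta> \<Longrightarrow> a + h \<in> I"
    and drift: "\<And>h k. \<bar>h\<bar> < \<eta> \<Longrightarrow> k \<le> Suc n \<Longrightarrow> \<bar>corner k (a + h) - corner k a\<bar> \<le> K * \<bar>h\<bar>"
    and sl_drift: "\<And>h k. \<bar>h\<bar> < \<eta> \<Longrightarrow> k \<le> n \<Longrightarrow> \<bar>sl k (a + h) - sl k a\<bar> \<le> K * \<bar>h\<bar>"
    and order: "\<And>h k. \<bar>h\<bar> < \<eta> \<Longrightarrow> k < n \<Longrightarrow> sl k (a + h) \<le> sl (Suc k) (a + h) \<longleftrightarrow> sl k a \<le> sl (Suc k) a"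
    and piece: "\<And>h k x. \<bar>h\<bar> < \<eta> \<Longrightarrow> k \<le> n \<Longrightarrow> \<bar>x\<bar> \<le> M \<Longrightarrow> \<bar>piece k (a + h) x - piece k a x - h * rate k x\<bar> \<le> K * h\<^sup>2"
    by (rule uniform_expansion[of M]) (rule that; assumption)
  define \<eta>' where "\<eta>' = min \<eta> (min (\<delta> / (K + 1)) (c / (2 * (K + 1))))"
  have \<eta>': "\<eta>' > 0" using K c by (simp add: \<eta>'_def)
  have small: "\<bar>h\<bar> < \<eta>" "K * \<bar>h\<bar> \<le> \<delta>" "K * \<bar>h\<bar> \<le> c / 2" if "\<bar>h\<bar> < \<eta>'" for h
  proof -
    show "\<bar>h\<bar> < \<eta>" using that by (simp add: \<eta>'_def)
    have "\<bar>h\<bar> < \<delta> / (K + 1)" "\<bar>h\<bar> < c / (2 * (K + 1))" using that by (auto simp: \<eta>'_def)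
    then have "\<bar>h\<bar> * (K + 1) < \<delta>" "\<bar>h\<bar> * (2 * (K + 1)) < c"
      using K by (simp_all add: pos_less_divide_eq)
    then show "K * \<bar>h\<bar> \<le> \<delta>" "K * \<bar>h\<bar> \<le> c / 2" by (simp_all add: algebra_simps)
  qed
  have piece_bounds: "(c / 2) * \<bar>h\<bar> \<le> sgn h * (piece k (a + h) x - piece k a x) \<and>
      sgn h * (piece k (a + h) x - piece k a x) \<le> (C + c) * \<bar>h\<bar>"
    if h: "\<bar>h\<bar> < \<eta>'" and k: "k \<le> n" and x: "corner k a - \<delta> \<le> x" "x \<le> corner (Suc k) a + \<delta>" for h k x
  proof -
    have "corner 0 a \<le> corner k a" "corner (Suc k) a \<le> corner (Suc n) a"
      using corner_mono[OF a_I] k by auto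
    then have "\<bar>x\<bar> \<le> M" using x c unfolding M_def by linarith
    then have E: "\<bar>piece k (a + h) x - piece k a x - h * rate k x\<bar> \<le> K * h\<^sup>2"
      using piece[OF small(1)[OF h] k] by blast
    have "K * h\<^sup>2 = (K * \<bar>h\<bar>) * \<bar>h\<bar>" by (simp add: power2_eq_square)
    also have "\<dots> \<le> (c / 2) * \<bar>h\<bar>" using small(3)[OF h] by (rule mult_right_mono) simp
    finally have E': "\<bar>piece k (a + h) x - piece k a x - h * rate k x\<bar> \<le> (c / 2) * \<bar>h\<bar>" using E by simp
    have "\<bar>sgn h * (piece k (a + h) x - piece k a x - h * rate k x)\<bar> \<le> (c / 2) * \<bar>h\<bar>"
      using E' by (auto simp: sgn_if abs_mult)
    moreover have "sgn h * (piece k (a + h) x - piece k a x - h * rate k x)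
        = sgn h * (piece k (a + h) x - piece k a x) - \<bar>h\<bar> * rate k x"
      by (auto simp: sgn_if algebra_simps)
    moreover have "\<bar>h\<bar> * c \<le> \<bar>h\<bar> * rate k x" "\<bar>h\<bar> * rate k x \<le> \<bar>h\<bar> * C"
      using rate[OF k x] by (auto intro!: mult_left_mono)
    moreover have "(c / 2) * \<bar>h\<bar> = \<bar>h\<bar> * c / 2" "(C + c) * \<bar>h\<bar> = \<bar>h\<bar> * C + \<bar>h\<bar> * c" "\<bar>h\<bar> * c \<ge> 0"
      using c by (simp_all add: algebra_simps)
    ultimately show ?thesis unfolding abs_le_iff by linarith
  qed
  have near: "(c / 2) * \<bar>h\<bar> \<le> sgn h * (F (a + h) y - F a y) \<and> sgn h * (F (a + h) y - F a y) \<le> (C + c) * \<bar>h\<bar>"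
    if h: "\<bar>h\<bar> < \<eta>'" and k: "k < n" and y: "\<bar>y - corner (Suc k) a\<bar> \<le> \<delta>" for h k y
  proof -
    let ?\<mu> = "a + h"
    have d: "\<bar>corner j ?\<mu> - corner j a\<bar> \<le> \<delta>" if "j \<le> Suc n" for j
      using drift[OF small(1)[OF h] that] small(2)[OF h] by linarith
    have g: "corner k a + 4 * \<delta> \<le> corner (Suc k) a" "corner (Suc k) a + 4 * \<delta> \<le> corner (Suc (Suc k)) a"
      using gap[of k] gap[of "Suc k"] k by auto
    have 0: "corner k a \<le> y" "y \<le> corner (Suc (Suc k)) a" using g y c by linarith+
    have 1: "corner k ?\<mu> \<le> y" "y \<le> corner (Suc (Suc k)) ?\<mu>"
      using g y c d[of k] d[of "Suc (Suc k)"] k by linarith+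
    have "corner k a - \<delta> \<le> y" "y \<le> corner (Suc k) a + \<delta>" using 0 y c by linarith+
    note p = piece_bounds[OF h _ this]
    have "corner (Suc k) a - \<delta> \<le> y" "y \<le> corner (Suc (Suc k)) a + \<delta>" using 0 y c by linarith+
    note p' = piece_bounds[OF h _ this]
    show ?thesis
      unfolding F_at_corner[OF a_I k 0] F_at_corner[OF inI[OF small(1)[OF h]] k 1] order[OF small(1)[OF h] k]
      using displacement_max_min[OF p p'] k by auto
  qed
  have "(c / 2) * \<bar>h\<bar> \<le> sgn h * (F (a + h) x - F a x) \<and> sgn h * (F (a + h) x - F a x) \<le> (C + c) * \<bar>h\<bar>"
    if h: "\<bar>h\<bar> < \<eta>'" for h x
  proof -
    note I' = inI[OF small(1)[OF h]]
    define m where "m = cell_shift x"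
    define k where "k = cell x"
    have shift: "F (a + h) x - F a x = F (a + h) (x - of_int j) - F a (x - of_int j)" for j
      using F_shift[OF I', of x "- j"] F_shift[OF a_I, of x "- j"] by simp
    have k: "1 \<le> k" "k \<le> n" "corner k a \<le> x - of_int m" "x - of_int m < corner (Suc k) a"
      using in_cell_cell[of x] by (simp_all add: in_cell_def k_def m_def)
    consider "x - of_int m \<le> corner k a + \<delta>" | "corner (Suc k) a - \<delta> \<le> x - of_int m" |
      "corner k a + \<delta> \<le> x - of_int m" "x - of_int m \<le> corner (Suc k) a - \<delta>" by linarith
    then show ?thesis
    proof cases
      case 1
      then show ?thesis using near[OF h, of "k - 1" "x - of_int m"] k unfolding shift[of m] by simp
    next
      case 2
      show ?thesis
      \<comment> \<open>The right end of the last cell is a translate of the corner of index \<open>1\<close>.\<close>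
      proof (cases "k = n")
        case True
        then have "\<bar>x - of_int (m + 1) - corner (Suc 0) a\<bar> \<le> \<delta>"
          using 2 k corner_last[OF a_I] by simp
        then show ?thesis using near[OF h, of 0] n_pos unfolding shift[of "m + 1"] by simp
      next
        case False
        have "\<bar>x - of_int m - corner (Suc k) a\<bar> \<le> \<delta>" using 2 k by simp
        then show ?thesis using near[OF h, of k] k False unfolding shift[of m] by simp
      qed
    next
      case 3
      have d: "\<bar>corner j (a + h) - corner j a\<bar> \<le> \<delta>" if "j \<le> Suc n" for j
        using drift[OF small(1)[OF h] that] small(2)[OF h] by linarith
      have "F (a + h) (x - of_int m) = piece k (a + h) (x - of_int m)"
        using 3 d[of k] d[of "Suc k"] k by (intro F_eq_piece[OF I']) auto
      moreover have "F a (x - of_int m) = piece k a (x - of_int m)"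
        using k by (intro F_eq_piece[OF a_I]) auto
      ultimately show ?thesis using piece_bounds[OF h k(2), of "x - of_int m"] k c
        unfolding shift[of m] by simp
    qed
  qed
  moreover have "c / 2 \<le> rate_at x \<and> rate_at x \<le> C + c" for x
  proof -
    have "c \<le> rate_at x \<and> rate_at x \<le> C"
      unfolding rate_at_def using in_cell_cell[of x] c by (intro rate) (auto simp: in_cell_def)
    then show ?thesis using c by auto
  qed
  moreover have "a + h \<in> I" if "\<bar>h\<bar> < \<eta>'" for h using inI small(1)[OF that] by blast
  ultimately show ?thesis using that[of "c / 2" "C + c" \<eta>'] \<eta>' c by auto
qed

text \<open>If \<open>x\<close> is at distance more than \<open>K * \<bar>h\<bar>\<close> from the corners, then \<open>y\<close> lies, for the parameter \<open>a + h\<close>, in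
the cell of the same index, because the corners move by \<open>O(h)\<close> only. There the map is affine in the point with coefficients
that have an expansion to second order.\<close>

lemma first_order_expansion:
  assumes "D \<ge> 0"
  obtains K \<eta> where "K \<ge> 0" "\<eta> > 0"
    "\<And>h x y. \<bar>h\<bar> < \<eta> \<Longrightarrow> (\<forall>s\<in>corners. K * \<bar>h\<bar> < \<bar>x - s\<bar>) \<Longrightarrow> \<bar>y - x\<bar> \<le> D * \<bar>h\<bar> \<Longrightarrow>
       \<bar>F (a + h) y - F a x - slope_at x * (y - x) - h * rate_at x\<bar> \<le> K * h\<^sup>2"
proof -
  define M where "M = \<bar>corner 0 a\<bar> + \<bar>corner (Suc n) a\<bar>"
  obtain K \<eta> where K: "K \<ge> 0" "\<eta> > 0"
    and inI: "\<And>h. \<bar>h\<bar> < \<eta> \<Longrightarrow> a + h \<in> I"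
    and drift: "\<And>h k. \<bar>h\<bar> < \<eta> \<Longrightarrow> k \<le> Suc n \<Longrightarrow> \<bar>corner k (a + h) - corner k a\<bar> \<le> K * \<bar>h\<bar>"
    and sl_drift: "\<And>h k. \<bar>h\<bar> < \<eta> \<Longrightarrow> k \<le> n \<Longrightarrow> \<bar>sl k (a + h) - sl k a\<bar> \<le> K * \<bar>h\<bar>"
    and order: "\<And>h k. \<bar>h\<bar> < \<eta> \<Longrightarrow> k < n \<Longrightarrow> sl k (a + h) \<le> sl (Suc k) (a + h) \<longleftrightarrow> sl k a \<le> sl (Suc k) a"
    and piece: "\<And>h k x. \<bar>h\<bar> < \<eta> \<Longrightarrow> k \<le> n \<Longrightarrow> \<bar>x\<bar> \<le> M \<Longrightarrow> \<bar>piece k (a + h) x - piece k a x - h * rate k x\<bar> \<le> K * h\<^sup>2"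
    by (rule uniform_expansion[of M]) (rule that; assumption)
  define K' where "K' = K + D + K * D"
  have K': "K' \<ge> 0" "K + D \<le> K'" "K + K * D \<le> K'" using K assms by (auto simp: K'_def)
  have "\<bar>F (a + h) y - F a x - slope_at x * (y - x) - h * rate_at x\<bar> \<le> K' * h\<^sup>2"
    if h: "\<bar>h\<bar> < \<eta>" and far: "\<forall>s\<in>corners. K' * \<bar>h\<bar> < \<bar>x - s\<bar>" and y: "\<bar>y - x\<bar> \<le> D * \<bar>h\<bar>" for h x y
  proof -
    define k where "k = cell x"
    define m where "m = cell_shift x"
    define X where "X = x - of_int m"
    define Y where "Y = y - of_int m"
    have k: "1 \<le> k" "k \<le> n" "corner k a \<le> X" "X < corner (Suc k) a"
      using in_cell_cell[of x] by (simp_all add: in_cell_def k_def m_def X_def)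
    have "(K + D) * \<bar>h\<bar> \<le> K' * \<bar>h\<bar>" using K' by (intro mult_right_mono) auto
    then have KD: "K * \<bar>h\<bar> + D * \<bar>h\<bar> \<le> K' * \<bar>h\<bar>" by (simp add: algebra_simps)
    have "K' * \<bar>h\<bar> < \<bar>x - (corner k a + of_int m)\<bar>" "K' * \<bar>h\<bar> < \<bar>x - (corner (Suc k) a + of_int m)\<bar>"
      using k by (auto intro!: far[rule_format] corner_in_corners)
    then have "corner k a + K' * \<bar>h\<bar> < X" "X < corner (Suc k) a - K' * \<bar>h\<bar>"
      using k by (simp_all add: X_def)
    then have "corner k (a + h) \<le> Y" "Y \<le> corner (Suc k) (a + h)"
      using drift[OF h le_SucI[OF k(2)]] drift[OF h Suc_le_mono[THEN iffD2, OF k(2)]] y KD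
      unfolding X_def Y_def abs_le_iff by linarith+
    then have "F (a + h) Y = piece k (a + h) Y" using F_eq_piece[OF inI[OF h] k(2)] by blast
    moreover have "F a X = piece k a X" using F_eq_piece[OF a_I k(2)] k by simp
    moreover have "F (a + h) Y = F (a + h) y - of_int m" "F a X = F a x - of_int m"
      using F_shift[OF inI[OF h], of y "- m"] F_shift[OF a_I, of x "- m"] by (simp_all add: X_def Y_def)
    ultimately have "F (a + h) y - F a x - slope_at x * (y - x) - h * rate_at x
        = (piece k (a + h) X - piece k a X - h * rate k X) + (sl k (a + h) - sl k a) * (y - x)"
      by (simp add: slope_at_def rate_at_def k_def[symmetric] m_def[symmetric] X_def Y_def piece_def algebra_simps)
    moreover have "\<bar>piece k (a + h) X - piece k a X - h * rate k X\<bar> \<le> K * h\<^sup>2"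
    proof (rule piece[OF h k(2)])
      have "corner 0 a \<le> corner k a" "corner (Suc k) a \<le> corner (Suc n) a"
        using corner_mono[OF a_I] k by auto
      then show "\<bar>X\<bar> \<le> M" using k unfolding M_def by linarith
    qed
    moreover have "\<bar>(sl k (a + h) - sl k a) * (y - x)\<bar> \<le> (K * \<bar>h\<bar>) * (D * \<bar>h\<bar>)"
      unfolding abs_mult using sl_drift[OF h k(2)] y K by (intro mult_mono) auto
    moreover have "(K * \<bar>h\<bar>) * (D * \<bar>h\<bar>) = K * D * h\<^sup>2" by (simp add: power2_eq_square)
    ultimately have "\<bar>F (a + h) y - F a x - slope_at x * (y - x) - h * rate_at x\<bar> \<le> K * h\<^sup>2 + K * D * h\<^sup>2"
      by linarith
    also have "\<dots> = (K + K * D) * h\<^sup>2" by (simp add: algebra_simps)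
    also have "\<dots> \<le> K' * h\<^sup>2" using K' by (intro mult_right_mono) auto
    finally show ?thesis .
  qed
  then show ?thesis using that[OF K'(1) K(2)] by blast
qed

end

section \<open>First variation along orbits\<close>

context transversal_family
begin

lemma F_lipschitz:
  obtains L where "L \<ge> 1" "\<And>x. slope_at x \<le> L" "\<And>x y. \<bar>F a x - F a y\<bar> \<le> L * \<bar>x - y\<bar>"
proof -
  obtain K where K: "K \<ge> 0" "\<And>k. k \<le> n \<Longrightarrow> sl k a \<le> K"
    using finite_upper_bound[of n "\<lambda>k. sl k a"] by blast
  define L where "L = K + 1"
  have L: "L \<ge> 1" using K by (simp add: L_def)
  have sl: "0 < sl k a" "sl k a \<le> L" if "k \<le> n" for k
    using K(2)[OF that] sl_pos[OF a_I that] by (auto simp: L_def)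
  have lip: "\<bar>F a u - F a v\<bar> \<le> L * \<bar>u - v\<bar>" if "u \<le> v" for u v
  proof -
    let ?U = "\<lambda>(k, m). {corner k a + of_int m..corner (Suc k) a + of_int m}"
    let ?J = "{1..n} \<times> {cell_shift u..cell_shift v}"
    have "L-lipschitz_on {u..v} (F a)"
    proof (rule lipschitz_on_closed_Union[where I = ?J and U = ?U])
      fix i assume i: "i \<in> ?J"
      obtain k m where km: "i = (k, m)" by force
      have k: "k \<le> n" using i km by simp
      have eq: "F a x = piece k a (x - of_int m) + of_int m"
        if "x \<in> {corner k a + of_int m..corner (Suc k) a + of_int m}" for x
        using F_eq_piece[OF a_I k, of "x - of_int m"] F_shift[OF a_I, of "x - of_int m" m] that by simp
      have "L-lipschitz_on {corner k a + of_int m..corner (Suc k) a + of_int m} (F a)"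
      proof (rule lipschitz_onI)
        fix x y assume x: "x \<in> {corner k a + of_int m..corner (Suc k) a + of_int m}"
          and y: "y \<in> {corner k a + of_int m..corner (Suc k) a + of_int m}"
        have "F a x - F a y = sl k a * (x - y)"
          by (simp add: eq[OF x] eq[OF y] piece_def algebra_simps)
        then have "\<bar>F a x - F a y\<bar> = sl k a * \<bar>x - y\<bar>" using sl[OF k] by (simp add: abs_mult)
        also have "\<dots> \<le> L * \<bar>x - y\<bar>" using sl[OF k] by (intro mult_right_mono) auto
        finally show "dist (F a x) (F a y) \<le> L * dist x y" by (simp add: dist_real_def)
      qed (use L in simp)
      then show "L-lipschitz_on (?U i) (F a)" by (simp add: km)
      show "closed (?U i)" by (simp add: km)
    next
      show "{u..v} \<subseteq> (\<Union>i\<in>?J. ?U i)"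
      proof
        fix x assume x: "x \<in> {u..v}"
        have "cell_shift u \<le> cell_shift x" "cell_shift x \<le> cell_shift v"
          unfolding cell_shift_def using x by (auto intro!: floor_mono)
        then have "(cell x, cell_shift x) \<in> ?J" "x \<in> ?U (cell x, cell_shift x)"
          using in_cell_cell[of x] by (auto simp: in_cell_def)
        then show "x \<in> (\<Union>i\<in>?J. ?U i)" by blast
      qed
    qed (use L in auto)
    from lipschitz_onD[OF this, of u v] that show ?thesis by (simp add: dist_real_def)
  qed
  have "\<bar>F a x - F a y\<bar> \<le> L * \<bar>x - y\<bar>" for x y
    using lip[of x y] lip[of y x] by (cases "x \<le> y") (auto simp: abs_minus_commute)
  moreover have "slope_at x \<le> L" for x
    unfolding slope_at_def using in_cell_cell[of x] by (intro sl) (simp add: in_cell_def)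
  ultimately show ?thesis using that L by blast
qed

lemma slope_at_pos: "slope_at x > 0"
  unfolding slope_at_def using in_cell_cell[of x] by (intro sl_pos a_I) (simp add: in_cell_def)

lemma iterate_lipschitz:
  assumes "L \<ge> 1" "\<And>x y. \<bar>F a x - F a y\<bar> \<le> L * \<bar>x - y\<bar>"
  shows "\<bar>(F a ^^ j) x - (F a ^^ j) y\<bar> \<le> L ^ j * \<bar>x - y\<bar>"
proof (induction j)
  case (Suc j)
  have "\<bar>(F a ^^ Suc j) x - (F a ^^ Suc j) y\<bar> \<le> L * \<bar>(F a ^^ j) x - (F a ^^ j) y\<bar>"
    using assms(2) by simp
  also have "\<dots> \<le> L * (L ^ j * \<bar>x - y\<bar>)" using Suc assms(1) by (intro mult_left_mono) auto
  finally show ?case by simp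
qed simp

text \<open>The derivative of \<open>(F \<mu> ^^ j) x\<close> in \<open>\<mu>\<close> at \<open>a\<close>, by the chain rule.\<close>

primrec variation :: "nat \<Rightarrow> real \<Rightarrow> real" where
  "variation 0 x = 0"
| "variation (Suc j) x = slope_at ((F a ^^ j) x) * variation j x + rate_at ((F a ^^ j) x)"

lemma iterate_shift: "(F a ^^ j) (x + of_int m) = (F a ^^ j) x + of_int m"
  by (rule degree_one_int[OF degree_one_funpow[OF degree_one_F[OF a_I]]])

lemma variation_periodic: "variation j (x + 1) = variation j x"
proof (induction j)
  case (Suc j)
  have "(F a ^^ j) (x + 1) = (F a ^^ j) x + 1" using iterate_shift[of j x 1] by simp
  then show ?case using Suc by (simp add: slope_at_def rate_at_def cell_periodic)
qed simp

lemma variation_lower_bound: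
  assumes "c \<ge> 0" "\<And>x. c \<le> rate_at x"
  shows "0 \<le> variation j x" "c \<le> variation (Suc j) x"
proof -
  show nonneg: "0 \<le> variation j x" for j
  proof (induction j)
    case (Suc j)
    then show ?case using slope_at_pos assms(1) order_trans[OF assms] by (simp add: less_imp_le)
  qed simp
  show "c \<le> variation (Suc j) x"
    using nonneg[of j] slope_at_pos[of "(F a ^^ j) x"] assms(2)[of "(F a ^^ j) x"]
    by (simp add: add_increasing less_imp_le)
qed

lemma variation_upper_bound:
  assumes "\<And>x. 0 \<le> rate_at x" "\<And>x. rate_at x \<le> C" "\<And>x. slope_at x \<le> L"
  shows "\<exists>B\<ge>0. \<forall>x. variation j x \<le> B"
proof (induction j)
  case (Suc j)
  then obtain B where B: "B \<ge> 0" "\<And>x. variation j x \<le> B" by blast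
  have "C \<ge> 0" "L \<ge> 0" using assms slope_at_pos by (meson order_trans less_imp_le)+
  have "variation (Suc j) x \<le> L * B + C" for x
    using B assms slope_at_pos variation_lower_bound(1)[of 0] assms(1) \<open>L \<ge> 0\<close>
    by (simp add: add_mono mult_mono less_imp_le)
  then show ?case using \<open>C \<ge> 0\<close> \<open>L \<ge> 0\<close> B by (intro exI[of _ "L * B + C"]) auto
qed (auto intro!: exI[of _ 0])

text \<open>When the iterates of a segment avoid the corners, its two endpoints have the same itinerary. The
slopes along both orbits then agree, and the rates differ by a bounded multiple of the distance of the orbits.\<close>

lemma variation_lipschitz:
  "\<exists>K\<ge>0. \<forall>x y. (\<forall>i<j. closed_segment ((F a ^^ i) x) ((F a ^^ i) y) \<inter> corners = {}) \<longrightarrow>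
     \<bar>variation j x - variation j y\<bar> \<le> K * \<bar>x - y\<bar>"
proof (induction j)
  case (Suc j)
  then obtain K where K: "K \<ge> 0" "\<And>x y. (\<forall>i<j. closed_segment ((F a ^^ i) x) ((F a ^^ i) y) \<inter> corners = {})
      \<Longrightarrow> \<bar>variation j x - variation j y\<bar> \<le> K * \<bar>x - y\<bar>" by blast
  obtain L where L: "L \<ge> 1" "\<And>x. slope_at x \<le> L" "\<And>x y. \<bar>F a x - F a y\<bar> \<le> L * \<bar>x - y\<bar>"
    using F_lipschitz by blast
  obtain D where D: "D \<ge> 0" "\<And>k. k \<le> n \<Longrightarrow> \<bar>deriv (sl k) a\<bar> \<le> D"
    using finite_upper_bound[of n "\<lambda>k. \<bar>deriv (sl k) a\<bar>"] by blast
  have "\<bar>variation (Suc j) x - variation (Suc j) y\<bar> \<le> (L * K + D * L ^ j) * \<bar>x - y\<bar>"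
    if avoid: "\<forall>i<Suc j. closed_segment ((F a ^^ i) x) ((F a ^^ i) y) \<inter> corners = {}" for x y
  proof -
    let ?x = "(F a ^^ j) x" and ?y = "(F a ^^ j) y"
    note same = cell_const[OF avoid[rule_format, OF lessI]]
    have "variation (Suc j) x - variation (Suc j) y
        = slope_at ?x * (variation j x - variation j y) + deriv (sl (cell ?x)) a * (?x - ?y)"
      by (simp add: slope_at_def rate_at_def rate_def same algebra_simps)
    moreover have "\<bar>slope_at ?x * (variation j x - variation j y)\<bar> \<le> L * (K * \<bar>x - y\<bar>)"
      unfolding abs_mult using slope_at_pos[of ?x] L K avoid by (intro mult_mono K(2)) auto
    moreover have "\<bar>deriv (sl (cell ?x)) a * (?x - ?y)\<bar> \<le> D * (L ^ j * \<bar>x - y\<bar>)"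
      unfolding abs_mult using in_cell_cell[of ?x] D iterate_lipschitz[OF L(1,3)]
      by (intro mult_mono D(2)) (auto simp: in_cell_def)
    ultimately have "\<bar>variation (Suc j) x - variation (Suc j) y\<bar> \<le> L * (K * \<bar>x - y\<bar>) + D * (L ^ j * \<bar>x - y\<bar>)"
      by linarith
    then show ?thesis by (simp add: algebra_simps)
  qed
  moreover have "L * K + D * L ^ j \<ge> 0" using L K D by simp
  ultimately show ?case by blast
qed (auto intro!: exI[of _ 0])

text \<open>The lower bound comes from the last step alone: by monotonicity, the earlier steps displace the
orbit in the same direction.\<close>

lemma iterate_perturbation:
  assumes C: "0 \<le> c" "0 \<le> C" and L: "L \<ge> 1" "\<And>x y. \<bar>F a x - F a y\<bar> \<le> L * \<bar>x - y\<bar>"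
    and inI: "a + h \<in> I"
    and step: "\<And>x. c * \<bar>h\<bar> \<le> sgn h * (F (a + h) x - F a x) \<and> sgn h * (F (a + h) x - F a x) \<le> C * \<bar>h\<bar>"
  shows "(if j = 0 then 0 else c * \<bar>h\<bar>) \<le> sgn h * ((F (a + h) ^^ j) x - (F a ^^ j) x) \<and>
    sgn h * ((F (a + h) ^^ j) x - (F a ^^ j) x) \<le> (j * C * L ^ j) * \<bar>h\<bar>"
proof (induction j)
  case (Suc j)
  define u v where "u = (F (a + h) ^^ j) x" and "v = (F a ^^ j) x"
  have IH: "0 \<le> sgn h * (u - v)" "sgn h * (u - v) \<le> (j * C * L ^ j) * \<bar>h\<bar>"
  proof -
    have "0 \<le> c * \<bar>h\<bar>" using C by simp
    then show "0 \<le> sgn h * (u - v)" using Suc unfolding u_def v_def by (auto split: if_splits)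
    show "sgn h * (u - v) \<le> (j * C * L ^ j) * \<bar>h\<bar>" using Suc unfolding u_def v_def by blast
  qed
  have mono: "F (a + h) y \<le> F (a + h) z" if "y \<le> z" for y z
    using degree_one_F[OF inI] that by (metis degree_one_def strict_mono_less_eq)
  have "0 \<le> sgn h * (F (a + h) u - F (a + h) v)"
    using IH(1) mono[of u v] mono[of v u] by (cases "h = 0"; cases "h > 0") (auto simp: sgn_if)
  moreover have "sgn h * (F (a + h) u - F a v)
      = sgn h * (F (a + h) u - F (a + h) v) + sgn h * (F (a + h) v - F a v)"
    by (simp add: algebra_simps)
  ultimately have lower: "c * \<bar>h\<bar> \<le> sgn h * (F (a + h) u - F a v)" using step[of v] by linarith
  have abs_uv: "\<bar>u - v\<bar> \<le> (j * C * L ^ j) * \<bar>h\<bar>" if "h \<noteq> 0"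
    using IH that by (auto simp: sgn_if split: if_splits)
  have "sgn h * (F a u - F a v) \<le> L * ((j * C * L ^ j) * \<bar>h\<bar>)"
  proof (cases "h = 0")
    case False
    have "sgn h * (F a u - F a v) \<le> \<bar>F a u - F a v\<bar>" by (auto simp: sgn_if)
    also have "\<dots> \<le> L * \<bar>u - v\<bar>" by (rule L)
    also have "\<dots> \<le> L * ((j * C * L ^ j) * \<bar>h\<bar>)" using abs_uv[OF False] L by (intro mult_left_mono) auto
    finally show ?thesis .
  qed simp
  moreover have "sgn h * (F (a + h) u - F a v)
      = sgn h * (F (a + h) u - F a u) + sgn h * (F a u - F a v)"
    by (simp add: algebra_simps)
  ultimately have "sgn h * (F (a + h) u - F a v) \<le> C * \<bar>h\<bar> + L * ((j * C * L ^ j) * \<bar>h\<bar>)"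
    using step[of u] by linarith
  also have "\<dots> \<le> (C * L ^ Suc j) * \<bar>h\<bar> + L * ((j * C * L ^ j) * \<bar>h\<bar>)"
  proof -
    have "C * 1 \<le> C * L ^ Suc j" using C L by (intro mult_left_mono one_le_power) auto
    then show ?thesis by (intro add_right_mono mult_right_mono) auto
  qed
  also have "\<dots> = (Suc j * C * L ^ Suc j) * \<bar>h\<bar>" by (simp add: algebra_simps)
  finally show ?case using lower by (simp add: u_def v_def)
qed simp

lemma iterate_expansion:
  "\<exists>K\<ge>0. \<exists>\<eta>>0. \<forall>h x. \<bar>h\<bar> < \<eta> \<longrightarrow> (\<forall>i<j. \<forall>s\<in>corners. K * \<bar>h\<bar> < \<bar>(F a ^^ i) x - s\<bar>) \<longrightarrow>
     \<bar>(F (a + h) ^^ j) x - (F a ^^ j) x - h * variation j x\<bar> \<le> K * h\<^sup>2"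
proof (induction j)
  case 0
  show ?case by (auto intro!: exI[of _ 0] exI[of _ 1])
next
  case (Suc j)
  obtain K1 \<eta>1 where 1: "K1 \<ge> 0" "\<eta>1 > 0"
    "\<And>h x. \<bar>h\<bar> < \<eta>1 \<Longrightarrow> (\<forall>i<j. \<forall>s\<in>corners. K1 * \<bar>h\<bar> < \<bar>(F a ^^ i) x - s\<bar>) \<Longrightarrow>
     \<bar>(F (a + h) ^^ j) x - (F a ^^ j) x - h * variation j x\<bar> \<le> K1 * h\<^sup>2"
    using Suc by blast
  obtain c C \<eta>2 where 2: "c > 0" "C > 0" "\<eta>2 > 0"
    and inI: "\<And>h. \<bar>h\<bar> < \<eta>2 \<Longrightarrow> a + h \<in> I"
    and rate: "\<And>x. c \<le> rate_at x \<and> rate_at x \<le> C"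
    and pert: "\<And>h x. \<bar>h\<bar> < \<eta>2 \<Longrightarrow> c * \<bar>h\<bar> \<le> sgn h * (F (a + h) x - F a x) \<and> sgn h * (F (a + h) x - F a x) \<le> C * \<bar>h\<bar>"
    by (rule perturbation_bounds) (rule that; assumption)
  obtain L where L: "L \<ge> 1" "\<And>x. slope_at x \<le> L" "\<And>x y. \<bar>F a x - F a y\<bar> \<le> L * \<bar>x - y\<bar>"
    using F_lipschitz by blast
  define D where "D = j * C * L ^ j"
  have D: "D \<ge> 0" using 2 L by (simp add: D_def)
  obtain K3 \<eta>3 where 3: "K3 \<ge> 0" "\<eta>3 > 0"
    "\<And>h x y. \<bar>h\<bar> < \<eta>3 \<Longrightarrow> (\<forall>s\<in>corners. K3 * \<bar>h\<bar> < \<bar>x - s\<bar>) \<Longrightarrow> \<bar>y - x\<bar> \<le> D * \<bar>h\<bar> \<Longrightarrow>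
       \<bar>F (a + h) y - F a x - slope_at x * (y - x) - h * rate_at x\<bar> \<le> K3 * h\<^sup>2"
    by (rule first_order_expansion[OF D]) (rule that; assumption)
  define K where "K = L * K1 + K3 + K1"
  have K: "K \<ge> 0" "K1 \<le> K" "K3 \<le> K" "L * K1 + K3 \<le> K" using 1 3 L by (simp_all add: K_def)
  have "\<bar>(F (a + h) ^^ Suc j) x - (F a ^^ Suc j) x - h * variation (Suc j) x\<bar> \<le> K * h\<^sup>2"
    if h: "\<bar>h\<bar> < min \<eta>1 (min \<eta>2 \<eta>3)"
      and far: "\<forall>i<Suc j. \<forall>s\<in>corners. K * \<bar>h\<bar> < \<bar>(F a ^^ i) x - s\<bar>" for h x
  proof -
    define u v where "u = (F (a + h) ^^ j) x" and "v = (F a ^^ j) x"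
    have Kh: "K1 * \<bar>h\<bar> \<le> K * \<bar>h\<bar>" "K3 * \<bar>h\<bar> \<le> K * \<bar>h\<bar>"
      using K by (auto intro!: mult_right_mono)
    have uv: "\<bar>u - v - h * variation j x\<bar> \<le> K1 * h\<^sup>2"
      unfolding u_def v_def using h far Kh(1) by (intro 1(3)) (auto intro: le_less_trans)
    have "\<bar>u - v\<bar> \<le> D * \<bar>h\<bar>"
    proof (cases "h = 0")
      case True
      then show ?thesis by (simp add: u_def v_def)
    next
      case False
      have lower: "0 \<le> (if j = 0 then 0 else c * \<bar>h\<bar>)" using 2 by simp
      have bounds: "(if j = 0 then 0 else c * \<bar>h\<bar>) \<le> sgn h * (u - v)" "sgn h * (u - v) \<le> D * \<bar>h\<bar>"
        using iterate_perturbation[OF _ _ L(1,3) inI pert, of h j x] h 2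
        unfolding u_def v_def D_def by auto
      have "0 \<le> sgn h * (u - v)" using lower bounds(1) by (rule order_trans)
      then show ?thesis using False bounds(2) by (auto simp: sgn_if split: if_splits)
    qed
    moreover have "\<forall>s\<in>corners. K3 * \<bar>h\<bar> < \<bar>v - s\<bar>"
    proof
      fix s assume "s \<in> corners"
      then have "K * \<bar>h\<bar> < \<bar>v - s\<bar>" using far lessI unfolding v_def by blast
      then show "K3 * \<bar>h\<bar> < \<bar>v - s\<bar>" using Kh(2) by linarith
    qed
    ultimately have E: "\<bar>F (a + h) u - F a v - slope_at v * (u - v) - h * rate_at v\<bar> \<le> K3 * h\<^sup>2"
      using h by (intro 3(3)) auto
    have "\<bar>slope_at v * (u - v - h * variation j x)\<bar> \<le> L * (K1 * h\<^sup>2)"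
      unfolding abs_mult using uv L(2)[of v] slope_at_pos[of v] L(1) by (intro mult_mono) auto
    moreover have "F (a + h) u - F a v - h * (slope_at v * variation j x + rate_at v)
       = (F (a + h) u - F a v - slope_at v * (u - v) - h * rate_at v) + slope_at v * (u - v - h * variation j x)"
      by (simp add: algebra_simps)
    ultimately have "\<bar>F (a + h) u - F a v - h * (slope_at v * variation j x + rate_at v)\<bar> \<le> K3 * h\<^sup>2 + L * (K1 * h\<^sup>2)"
      using E by linarith
    also have "\<dots> = (L * K1 + K3) * h\<^sup>2" by (simp add: algebra_simps)
    also have "\<dots> \<le> K * h\<^sup>2" using K by (intro mult_right_mono) auto
    finally show ?thesis by (simp add: u_def v_def)
  qed
  moreover have "min \<eta>1 (min \<eta>2 \<eta>3) > 0" using 1 2 3 by simp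
  ultimately show ?case using K(1) by blast
qed

end

section \<open>The return map at the critical parameter\<close>

locale periodic_transversal_family = transversal_family +
  fixes p :: int and q :: nat
  assumes q_pos: "q > 0" and return: "\<And>x. (F a ^^ q) x = x + of_int p"
begin

text \<open>The preimages of the corners under the first \<open>q - 1\<close> iterates, and the corners themselves: since \<open>F a ^^ q\<close> is an
integer translation, the preimage under \<open>F a ^^ i\<close> is, up to translation, the image under \<open>F a ^^ (q - i)\<close>.\<close>

definition orbit_corners :: "real set" where
  "orbit_corners = (\<lambda>(i, k). (F a ^^ i) (corner k a)) ` ({1..q} \<times> {1..n})"

lemma finite_orbit_corners: "finite orbit_corners"
  by (simp add: orbit_corners_def)

lemma iterate_return:
  assumes "i \<le> q"
  shows "(F a ^^ i) ((F a ^^ (q - i)) x) = x + of_int p" "(F a ^^ (q - i)) ((F a ^^ i) x) = x + of_int p"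
proof -
  have "(F a ^^ i) ((F a ^^ (q - i)) x) = (F a ^^ (i + (q - i))) x" by (simp add: funpow_add)
  then show "(F a ^^ i) ((F a ^^ (q - i)) x) = x + of_int p" using assms return by simp
  have "(F a ^^ (q - i)) ((F a ^^ i) x) = (F a ^^ ((q - i) + i)) x" by (simp add: funpow_add)
  then show "(F a ^^ (q - i)) ((F a ^^ i) x) = x + of_int p" using assms return by simp
qed

lemma corner_preimage:
  assumes "i < q" "s \<in> corners"
  shows "(F a ^^ (q - i)) s - of_int p \<in> int_translates orbit_corners"
    and "(F a ^^ i) ((F a ^^ (q - i)) s - of_int p) = s"
proof -
  obtain k m where k: "k \<in> {1..n}" "s = corner k a + of_int m"
    using assms(2) by (auto simp: corners_def int_translates_iff)
  have "(F a ^^ (q - i)) (corner k a) \<in> orbit_corners"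
    unfolding orbit_corners_def using assms(1) k by (intro image_eqI[where x = "(q - i, k)"]) auto
  moreover have "(F a ^^ (q - i)) s - of_int p = (F a ^^ (q - i)) (corner k a) + of_int (m - p)"
    by (simp add: k iterate_shift)
  ultimately show "(F a ^^ (q - i)) s - of_int p \<in> int_translates orbit_corners"
    unfolding int_translates_iff by blast
  have "(F a ^^ i) ((F a ^^ (q - i)) s + of_int (- p)) = (F a ^^ i) ((F a ^^ (q - i)) s) + of_int (- p)"
    by (rule iterate_shift)
  then show "(F a ^^ i) ((F a ^^ (q - i)) s - of_int p) = s"
    using iterate_return(1)[of i s] assms(1) by simp
qed

text \<open>Pulling back by \<open>F a ^^ i\<close> amounts to applying \<open>F a ^^ (q - i)\<close>, so a Lipschitz bound for \<open>F a\<close>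
controls distances of preimages.\<close>

lemma orbit_far_from_corners:
  assumes L: "L \<ge> 1" "\<And>x y. \<bar>F a x - F a y\<bar> \<le> L * \<bar>x - y\<bar>" and r: "r \<ge> 0"
    and far: "\<And>s. s \<in> int_translates orbit_corners \<Longrightarrow> L ^ q * r < \<bar>x - s\<bar>"
    and i: "i < q" and s: "s \<in> corners"
  shows "r < \<bar>(F a ^^ i) x - s\<bar>"
proof (rule ccontr)
  assume "\<not> r < \<bar>(F a ^^ i) x - s\<bar>"
  then have near: "\<bar>(F a ^^ i) x - s\<bar> \<le> r" by simp
  have "\<bar>x - ((F a ^^ (q - i)) s - of_int p)\<bar> = \<bar>(F a ^^ (q - i)) ((F a ^^ i) x) - (F a ^^ (q - i)) s\<bar>"
    using iterate_return(2)[of i x] i by simp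
  also have "\<dots> \<le> L ^ (q - i) * \<bar>(F a ^^ i) x - s\<bar>" by (rule iterate_lipschitz[OF L])
  also have "\<dots> \<le> L ^ q * r" using near L(1) by (intro mult_mono power_increasing) auto
  finally show False using far[OF corner_preimage(1)[OF i s]] by simp
qed

lemma segment_iterates_avoid_corners:
  assumes avoid: "closed_segment x y \<inter> int_translates orbit_corners = {}" and i: "i < q"
  shows "closed_segment ((F a ^^ i) x) ((F a ^^ i) y) \<inter> corners = {}"
proof (rule ccontr)
  assume "closed_segment ((F a ^^ i) x) ((F a ^^ i) y) \<inter> corners \<noteq> {}"
  then obtain s where s: "s \<in> closed_segment ((F a ^^ i) x) ((F a ^^ i) y)" "s \<in> corners" by blast
  define z where "z = (F a ^^ (q - i)) s - of_int p"
  have z: "z \<in> int_translates orbit_corners" "(F a ^^ i) z = s"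
    using corner_preimage[OF i s(2)] by (simp_all add: z_def)
  have "strict_mono (F a ^^ i)"
    using degree_one_funpow[OF degree_one_F[OF a_I]] by (simp add: degree_one_def)
  then have "z \<in> closed_segment x y"
    using s(1) unfolding z(2)[symmetric]
    by (auto simp: closed_segment_eq_real_ivl strict_mono_less_eq split: if_splits)
  with z avoid show False by blast
qed

text \<open>The estimate of the drift is applied to the return map, with the first variation of \<open>F a ^^ q\<close> as limiting
speed. The constant \<open>T\<close> is the time that the flow with this speed takes for one lap.\<close>

lemma rotation_number_expansion:
  obtains T K \<eta> where "T > 0" "K \<ge> 0" "\<eta> > 0"
    "\<And>h. \<bar>h\<bar> < \<eta> \<Longrightarrow> a + h \<in> I"
    "\<And>h. \<bar>h\<bar> < \<eta> \<Longrightarrow> h \<noteq> 0 \<Longrightarrow> \<bar>T * (q * rotation_number (F (a + h)) - of_int p) - h\<bar> \<le> K * h\<^sup>2"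
proof -
  obtain c C \<eta>1 where 1: "c > 0" "C > 0" "\<eta>1 > 0"
    and inI: "\<And>h. \<bar>h\<bar> < \<eta>1 \<Longrightarrow> a + h \<in> I"
    and rate: "\<And>x. c \<le> rate_at x \<and> rate_at x \<le> C"
    and pert: "\<And>h x. \<bar>h\<bar> < \<eta>1 \<Longrightarrow> c * \<bar>h\<bar> \<le> sgn h * (F (a + h) x - F a x) \<and> sgn h * (F (a + h) x - F a x) \<le> C * \<bar>h\<bar>"
    by (rule perturbation_bounds) (rule that; assumption)
  obtain L where L: "L \<ge> 1" "\<And>x. slope_at x \<le> L" "\<And>x y. \<bar>F a x - F a y\<bar> \<le> L * \<bar>x - y\<bar>"
    using F_lipschitz by blast
  obtain K2 \<eta>2 where 2: "K2 \<ge> 0" "\<eta>2 > 0"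
    "\<And>h x. \<bar>h\<bar> < \<eta>2 \<Longrightarrow> (\<forall>i<q. \<forall>s\<in>corners. K2 * \<bar>h\<bar> < \<bar>(F a ^^ i) x - s\<bar>) \<Longrightarrow>
     \<bar>(F (a + h) ^^ q) x - (F a ^^ q) x - h * variation q x\<bar> \<le> K2 * h\<^sup>2"
    using iterate_expansion[of q] by blast
  obtain B where B: "\<And>x. variation q x \<le> B"
    using variation_upper_bound[of C L q] rate L(2) 1(1) by (meson less_imp_le order_trans)
  obtain M where M: "M \<ge> 0" "\<And>x y. (\<forall>i<q. closed_segment ((F a ^^ i) x) ((F a ^^ i) y) \<inter> corners = {})
      \<Longrightarrow> \<bar>variation q x - variation q y\<bar> \<le> M * \<bar>x - y\<bar>"
    using variation_lipschitz[of q] by blast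
  define U where "U = max B (q * C * L ^ q)"
  have "q * C * L ^ q > 0" using q_pos 1 L by simp
  then have U: "U > 0" "B \<le> U" "q * C * L ^ q \<le> U" by (auto simp: U_def)
  obtain q' where q': "q = Suc q'" using q_pos gr0_implies_Suc by blast
  interpret speed "variation q" orbit_corners c U M
  proof
    show "c \<le> variation q x" for x
      unfolding q' using 1(1) rate by (intro variation_lower_bound) auto
    show "variation q x \<le> U" for x using B[of x] U by simp
    show "\<bar>variation q x - variation q y\<bar> \<le> M * \<bar>x - y\<bar>"
      if "closed_segment x y \<inter> int_translates orbit_corners = {}" for x y
      using segment_iterates_avoid_corners[OF that] by (intro M(2)) blast
  qed (use finite_orbit_corners 1 M variation_periodic in auto)
  define K where "K = max U (L ^ q * K2)"
  have "K2 * 1 \<le> K2 * L ^ q" using 2 L by (intro mult_left_mono one_le_power) auto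
  then have K: "U \<le> K" "L ^ q * K2 \<le> K" "K2 \<le> K" "K > 0"
    using U(1) by (auto simp: K_def mult.commute)
  define \<eta> where "\<eta> = min \<eta>1 (min \<eta>2 (1 / (4 * K)))"
  have \<eta>: "\<eta> > 0" using 1 2 K by (simp add: \<eta>_def)
  define K' where "K' = M / c\<^sup>2 * U\<^sup>2 + K / c + 4 * K * card orbit_corners * U / c"
  have "K' \<ge> 0" using M 1 U K by (simp add: K'_def)
  moreover have "\<bar>clock 1 * (q * rotation_number (F (a + h)) - of_int p) - h\<bar> \<le> K' * h\<^sup>2"
    if h: "\<bar>h\<bar> < \<eta>" "h \<noteq> 0" for h
  proof -
    let ?G = "\<lambda>x. (F (a + h) ^^ q) x - of_int p"
    have h': "\<bar>h\<bar> < \<eta>1" "\<bar>h\<bar> < \<eta>2" "\<bar>h\<bar> < 1 / (4 * K)" using h by (auto simp: \<eta>_def)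
    have G: "?G x - x = (F (a + h) ^^ q) x - (F a ^^ q) x" for x by (simp add: return)
    have "\<bar>clock 1 * (q * rotation_number (F (a + h)) - of_int p) - sgn h * \<bar>h\<bar>\<bar> \<le> K' * \<bar>h\<bar>\<^sup>2"
      unfolding K'_def
    proof (rule drift_estimate[where G = ?G])
      show "0 < \<bar>h\<bar>" using h by simp
      show "2 * K * \<bar>h\<bar> < 1 / 2" using h'(3) K(4) by (simp add: field_simps)
      show "sgn h \<in> {1, - 1}" using h by (auto simp: sgn_if)
      show "(\<lambda>m. ((?G ^^ m) 0 - 0) / real m) \<longlonglongrightarrow> real q * rotation_number (F (a + h)) - of_int p"
        by (rule return_map_limit[OF degree_one_F[OF inI[OF h'(1)]] q_pos])
      show "c * \<bar>h\<bar> \<le> sgn h * (?G x - x) \<and> sgn h * (?G x - x) \<le> U * \<bar>h\<bar>" for x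
      proof -
        have "(q * C * L ^ q) * \<bar>h\<bar> \<le> U * \<bar>h\<bar>" using U by (intro mult_right_mono) auto
        then show ?thesis unfolding G
          using iterate_perturbation[OF _ _ L(1,3) inI[OF h'(1)] pert[OF h'(1)], of q x] 1 q_pos by auto
      qed
      show "\<bar>sgn h * (?G x - x) - \<bar>h\<bar> * variation q x\<bar> \<le> K * \<bar>h\<bar>\<^sup>2"
        if far: "\<And>s. s \<in> int_translates orbit_corners \<Longrightarrow> K * \<bar>h\<bar> < \<bar>x - s\<bar>" for x
      proof -
        have "L ^ q * (K2 * \<bar>h\<bar>) \<le> K * \<bar>h\<bar>"
          using K(2) mult_right_mono[of "L ^ q * K2" K "\<bar>h\<bar>"] by (simp add: mult.assoc)
        then have "L ^ q * (K2 * \<bar>h\<bar>) < \<bar>x - s\<bar>" if "s \<in> int_translates orbit_corners" for s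
          using far[OF that] by simp
        then have "\<forall>i<q. \<forall>s\<in>corners. K2 * \<bar>h\<bar> < \<bar>(F a ^^ i) x - s\<bar>"
          using 2(1) by (intro allI impI ballI orbit_far_from_corners[OF L(1,3)]) auto
        then have "\<bar>(?G x - x) - h * variation q x\<bar> \<le> K2 * h\<^sup>2"
          unfolding G using h'(2) by (intro 2(3))
        also have "\<dots> \<le> K * h\<^sup>2" using K by (intro mult_right_mono) auto
        finally have "\<bar>sgn h * ((?G x - x) - h * variation q x)\<bar> \<le> K * h\<^sup>2"
          using h by (simp add: abs_mult abs_sgn_eq)
        moreover have "sgn h * ((?G x - x) - h * variation q x) = sgn h * (?G x - x) - \<bar>h\<bar> * variation q x"
          by (auto simp: sgn_if)
        ultimately show ?thesis by simp
      qed
    qed (use U K in auto)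
    then show ?thesis using h by (simp add: sgn_mult_abs)
  qed
  moreover have "a + h \<in> I" if "\<bar>h\<bar> < \<eta>" for h using inI that by (simp add: \<eta>_def)
  ultimately show ?thesis using that[of "clock 1" K' \<eta>] clock_1_pos \<eta> by blast
qed

end

section \<open>Linear growth of the rotation number\<close>

theorem theorem2p6:
  fixes I :: "real set" and n :: nat
    and b \<phi> :: "nat \<Rightarrow> real \<Rightarrow> real"
    and F :: "real \<Rightarrow> real \<Rightarrow> real" and f :: "real \<Rightarrow> circle \<Rightarrow> circle"
    and \<mu>\<^sub>c :: real and p :: int and q :: nat
  assumes "open I" and "is_interval I"
    and "n \<ge> 2"
    and "pwl_family I n b \<phi> F f"
    and "\<And>k. k \<in> {1..n} \<Longrightarrow> C2_on I (b k)"
    and "\<And>k. k \<in> {1..n} \<Longrightarrow> C2_on I (\<phi> k)"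
    and "\<mu>\<^sub>c \<in> I"
    and "\<exists>\<omega>\<in>\<rat>. circle_conjugate (f \<mu>\<^sub>c) (rigid_rotation \<omega>)"
    and "q > 0"
    and "rotation_number (F \<mu>\<^sub>c) = of_int p / of_nat q"
    and "\<And>k. k \<in> {1..n} \<Longrightarrow>
           deriv (\<phi> k) \<mu>\<^sub>c
             - Max {0, slope n b \<phi> (k - 1) \<mu>\<^sub>c * deriv (b k) \<mu>\<^sub>c,
                       slope n b \<phi> k \<mu>\<^sub>c * deriv (b k) \<mu>\<^sub>c} > 0"
  shows "\<exists>N R\<^sub>1 R\<^sub>2. open N \<and> \<mu>\<^sub>c \<in> N \<and> N \<subseteq> I \<and> R\<^sub>1 > 0 \<and> R\<^sub>2 > 0 \<and>
           (\<forall>\<mu>\<in>N. \<bar>rotation_number (F \<mu>) - of_int p / of_nat q - R\<^sub>1 * (\<mu> - \<mu>\<^sub>c)\<bar>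
                    \<le> R\<^sub>2 * (\<mu> - \<mu>\<^sub>c)\<^sup>2)"
proof -
  have lift: "is_lift (F \<mu>\<^sub>c) (f \<mu>\<^sub>c)" using assms(4,7) by (simp add: pwl_family_def)
  interpret periodic_transversal_family I n b \<phi> F f \<mu>\<^sub>c p q
  proof
    show "(F \<mu>\<^sub>c ^^ q) x = x + of_int p" for x
      using conjugate_rational_rotation_return_map[OF lift assms(8-10)] .
  qed (use assms in auto)
  obtain T K \<eta> where T: "T > 0" "K \<ge> 0" "\<eta> > 0"
    and inI: "\<And>h. \<bar>h\<bar> < \<eta> \<Longrightarrow> \<mu>\<^sub>c + h \<in> I"
    and est: "\<And>h. \<bar>h\<bar> < \<eta> \<Longrightarrow> h \<noteq> 0 \<Longrightarrow> \<bar>T * (q * rotation_number (F (\<mu>\<^sub>c + h)) - of_int p) - h\<bar> \<le> K * h\<^sup>2"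
    by (rule rotation_number_expansion) (rule that; assumption)
  define R\<^sub>1 where "R\<^sub>1 = 1 / (q * T)"
  \<comment> \<open>The summand \<open>1\<close> keeps this constant positive even if \<open>K = 0\<close>.\<close>
  define R\<^sub>2 where "R\<^sub>2 = (K + 1) / (q * T)"
  have R: "R\<^sub>1 > 0" "R\<^sub>2 > 0" using T \<open>q > 0\<close> by (simp_all add: R\<^sub>1_def R\<^sub>2_def)
  have "\<bar>rotation_number (F \<mu>) - of_int p / of_nat q - R\<^sub>1 * (\<mu> - \<mu>\<^sub>c)\<bar> \<le> R\<^sub>2 * (\<mu> - \<mu>\<^sub>c)\<^sup>2"
    if "\<mu> \<in> ball \<mu>\<^sub>c \<eta>" for \<mu>
  proof (cases "\<mu> = \<mu>\<^sub>c")
    case True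
    then show ?thesis using assms(10) by simp
  next
    case False
    define h where "h = \<mu> - \<mu>\<^sub>c"
    have h: "\<bar>h\<bar> < \<eta>" "h \<noteq> 0" "\<mu> = \<mu>\<^sub>c + h"
      using that False by (auto simp: h_def dist_real_def)
    have "rotation_number (F \<mu>) - of_int p / of_nat q - R\<^sub>1 * h
        = (T * (q * rotation_number (F \<mu>) - of_int p) - h) / (q * T)"
      using T \<open>q > 0\<close> by (simp add: R\<^sub>1_def field_simps)
    then have "\<bar>rotation_number (F \<mu>) - of_int p / of_nat q - R\<^sub>1 * h\<bar>
        = \<bar>T * (q * rotation_number (F \<mu>) - of_int p) - h\<bar> / (q * T)"
      using T by simp
    also have "\<dots> \<le> K * h\<^sup>2 / (q * T)"
      using est[OF h(1,2)] T unfolding h(3)[symmetric] by (intro divide_right_mono) auto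
    also have "\<dots> \<le> (K + 1) * h\<^sup>2 / (q * T)"
      using T by (intro divide_right_mono mult_right_mono) auto
    finally show ?thesis by (simp add: R\<^sub>2_def h_def)
  qed
  moreover have "ball \<mu>\<^sub>c \<eta> \<subseteq> I"
  proof
    fix \<mu> assume "\<mu> \<in> ball \<mu>\<^sub>c \<eta>"
    then show "\<mu> \<in> I" using inI[of "\<mu> - \<mu>\<^sub>c"] by (simp add: dist_real_def abs_minus_commute)
  qed
  ultimately show ?thesis using R T
    by (intro exI[of _ "ball \<mu>\<^sub>c \<eta>"] exI[of _ R\<^sub>1] exI[of _ R\<^sub>2]) auto
qed

end
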